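(* Let $(R,\mathfrak{m})$ be a regular local ring of dimension $n$ essentially of finite type over a field of characteristic zero, let $\Phi$ be an additive subsemigroup of the non-negative real numbers, and let $\mathfrak{a}_\bullet=\{\mathfrak{a}_m\}_{m\in\Phi}$ and $\mathfrak{b}_\bullet=\{\mathfrak{b}_m\}_{m\in\Phi}$ be two graded families of $\mathfrak{m}$-primary ideals of $R$ satisfying $\mathfrak{a}_m\subseteq\mathfrak{a}_{m'}$ and $\mathfrak{b}_m\subseteq\mathfrak{b}_{m'}$ whenever $m,m'\in\Phi$ and $m\ge m'$. Assume that there are non-zero elements $\delta,\delta'\in R$ such that $\delta\cdot\mathfrak{j}_m(\mathfrak{a}_\bullet)\subseteq\mathfrak{a}_m$ and $\delta'\cdot\mathfrak{j}_m(\mathfrak{b}_\bullet)\subseteq\mathfrak{b}_m$ for all $m\in\Phi$, where $\mathfrak{j}_m(\cdot)$ denotes the asymptotic multiplier ideals. Let $\mathfrak{a}_\bullet\cap\mathfrak{b}_\bullet=\{\mathfrak{a}_m\cap\mathfrak{b}_m\}_{m\in\Phi}$ and $\mathfrak{a}_\bullet\mathfrak{b}_\bullet=\{\mathfrak{a}_m\mathfrak{b}_m\}_{m\in\Phi}$ be the intersection and product graded families. Then $$\mathrm{vol}(\mathfrak{a}_\bullet\cap\mathfrak{b}_\bullet)^{1/n}\ \le\ \mathrm{vol}(\mathfrak{a}_\bullet\mathfrak{b}_\bullet)^{1/n}\ \le\ \mathrm{vol}(\mathfrak{a}_\bullet)^{1/n}+\mathrm{vol}(\mathfrak{b}_\b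ullet)^{1/n}.$$
   Context: A graded family of ideals indexed by $\Phi$ is a collection $\{\mathfrak{a}_m\}_{m\in\Phi}$ with $\mathfrak{a}_m\mathfrak{a}_\ell\subseteq\mathfrak{a}_{m+\ell}$ for all $m,\ell\in\Phi$ (with $\mathfrak{a}_0=R$ by convention; $\mathfrak{m}$-primary is required for positive indices). The volume of a graded family of $\mathfrak{m}$-primary ideals is $$\mathrm{vol}(\mathfrak{a}_\bullet)=\limsup_{m\in\Phi,\,m\to\infty}\frac{\mathrm{length}(R/\mathfrak{a}_m)}{m^n/n!}.$$ Multiplier ideals. Let $X=\mathrm{Spec}\,R$, let $\mathfrak{a}\subseteq R$ be a non-zero ideal and $c>0$ rational. Take a log resolution $\mu:X'\to X$ of $\mathfrak{a}$: a projective birational map from a regular scheme $X'$ with $\mathfrak{a}\mathcal{O}_{X'}=\mathcal{O}_{X'}(-F)$, $F$ an effective Cartier divisor such that the sum of $F$ and the exceptional divisor of $\mu$ has simple normal crossing support. Then $\mathcal{J}(c\cdot\mathfrak{a})=\mu_*\mathcal{O}_{X'}(K_{X'/X}-[cF])$, where $K_{X'/X}=K_{X'}-\mu^*K_X$ and $[cF]$ is obtained by rounding down coefficients; this is independent of $\mu$. The $m$-th asymptotic multiplier ideal $\mathfrak{j}_m(\mathfrak{a}_\bullet)$ is the unique maximal element of the set $\{\mathcal{J}(\tfrac1p\cdot\mathfrak{a}_{pm})\}_{p\in\mathbb{N},\,p\ge1}$. *)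

theory Defs
  imports
    Complex_Main
    "HOL-Algebra.Algebra"
    "HOL-Combinatorics.Permutations"
    "HOL-Library.Extended_Nat"
    "HOL-Library.Extended_Nonnegative_Real"
    "HOL-Library.Liminf_Limsup"
begin

text \<open>
  All rings that occur are subrings of one field \<open>K\<close>, the fraction field of the regular local
  ring \<open>R\<close>. A subring is given by its carrier \<open>A\<close>, and \<open>K \<restriction> A\<close> is the ring on it.
\<close>

abbreviation sub_ring :: "('a, 'b) ring_scheme \<Rightarrow> 'a set \<Rightarrow> ('a, 'b) ring_scheme"
    (infixl "\<restriction>" 95) where
  "K \<restriction> A \<equiv> K\<lparr>carrier := A\<rparr>"


section \<open>Length, dimension, regular local rings\<close>

definition chain_length :: "'a set set \<Rightarrow> enat" where
  "chain_length S =
     Sup {enat l | l. \<exists>c. (\<forall>i\<le>l. c i \<in> S) \<and> (\<forall>i<l. c i \<subset> c (Suc i))}"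

definition krull_dim :: "('a, 'b) ring_scheme \<Rightarrow> enat" where
  "krull_dim A = chain_length {P. primeideal P A}"

text \<open>
  The \<open>A\<close>-submodules of \<open>A / I\<close> are the ideals of the quotient ring, so the length of the
  module \<open>A / I\<close> is the length of \<open>A Quot I\<close> as a module over itself.
\<close>

definition ring_length :: "('a, 'b) ring_scheme \<Rightarrow> enat" where
  "ring_length A = chain_length {I. ideal I A}"

definition local_ring :: "('a, 'b) ring_scheme \<Rightarrow> bool" where
  "local_ring A \<longleftrightarrow> cring A \<and> (\<exists>!M. maximalideal M A)"

definition max_ideal :: "('a, 'b) ring_scheme \<Rightarrow> 'a set" where
  "max_ideal A = (THE M. maximalideal M A)"

definition regular_parameters :: "('a, 'b) ring_scheme \<Rightarrow> 'a list \<Rightarrow> bool" where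
  "regular_parameters A ts \<longleftrightarrow>
     set ts \<subseteq> carrier A \<and> krull_dim A = enat (length ts) \<and> Idl\<^bsub>A\<^esub> (set ts) = max_ideal A"

definition regular_local_ring :: "('a, 'b) ring_scheme \<Rightarrow> bool" where
  "regular_local_ring A \<longleftrightarrow>
     noetherian_ring A \<and> local_ring A \<and> (\<exists>ts. regular_parameters A ts)"


section \<open>Fractions, localizations, rings essentially of finite type\<close>

definition fraction_field_of :: "('a, 'b) ring_scheme \<Rightarrow> 'a set \<Rightarrow> bool" where
  "fraction_field_of K R \<longleftrightarrow> field K \<and> subring R K \<and>
     (\<forall>x\<in>carrier K. \<exists>a\<in>R. \<exists>b\<in>R - {\<zero>\<^bsub>K\<^esub>}. x = a \<otimes>\<^bsub>K\<^esub> inv\<^bsub>K\<^esub> b)"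

definition localization :: "('a, 'b) ring_scheme \<Rightarrow> 'a set \<Rightarrow> 'a set \<Rightarrow> 'a set" where
  "localization K B S = {a \<otimes>\<^bsub>K\<^esub> inv\<^bsub>K\<^esub> s | a s. a \<in> B \<and> s \<in> S}"

definition essentially_finite_type :: "('a, 'b) ring_scheme \<Rightarrow> 'a set \<Rightarrow> 'a set \<Rightarrow> bool" where
  "essentially_finite_type K k R \<longleftrightarrow>
     (\<exists>T S. finite T \<and> T \<subseteq> carrier K \<and>
        (let B = generate_ring K (k \<union> T) in
           S \<subseteq> B - {\<zero>\<^bsub>K\<^esub>} \<and> \<one>\<^bsub>K\<^esub> \<in> S \<and> (\<forall>s\<in>S. \<forall>t\<in>S. s \<otimes>\<^bsub>K\<^esub> t \<in> S) \<and>
           R = localization K B S))"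

definition char_zero :: "('a, 'b) ring_scheme \<Rightarrow> bool" where
  "char_zero A \<longleftrightarrow> (\<forall>n::nat. n > 0 \<longrightarrow> add_pow A n \<one>\<^bsub>A\<^esub> \<noteq> \<zero>\<^bsub>A\<^esub>)"


section \<open>Schemes projective and birational over \<open>Spec R\<close>\<close>

text \<open>
  An integral separated scheme with function field \<open>K\<close> is encoded, after Zariski, by the set of its
  local rings inside \<open>K\<close>: \<open>affine_points K B\<close> is \<open>Spec B\<close>. The point \<open>x\<close> lies in the closure of
  the point \<open>y\<close> iff the local ring of \<open>x\<close> is contained in that of \<open>y\<close>.
  A scheme that is projective and birational over \<open>Spec R\<close> is an integral closed subscheme of some
  projective space over \<open>R\<close> whose function field is \<open>K\<close>. Its homogeneous coordinates are, up to a
  common factor, elements \<open>x\<^sub>0, \<dots>, x\<^sub>N\<close> of \<open>K\<close>, not all zero, and it is covered by the charts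
  \<open>Spec R[x\<^sub>0/x\<^sub>i, \<dots>, x\<^sub>N/x\<^sub>i]\<close> with \<open>x\<^sub>i \<noteq> 0\<close>.
\<close>

definition affine_points :: "('a, 'b) ring_scheme \<Rightarrow> 'a set \<Rightarrow> 'a set set" where
  "affine_points K B = {localization K B (B - P) | P. primeideal P (K \<restriction> B)}"

definition chart :: "('a, 'b) ring_scheme \<Rightarrow> 'a set \<Rightarrow> 'a set \<Rightarrow> 'a \<Rightarrow> 'a set" where
  "chart K R xs x = generate_ring K (R \<union> {y \<otimes>\<^bsub>K\<^esub> inv\<^bsub>K\<^esub> x | y. y \<in> xs})"

definition projective_birational :: "('a, 'b) ring_scheme \<Rightarrow> 'a set \<Rightarrow> 'a set set \<Rightarrow> bool" where
  "projective_birational K R Y \<longleftrightarrow>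
     (\<exists>xs. finite xs \<and> xs \<subseteq> carrier K \<and> xs - {\<zero>\<^bsub>K\<^esub>} \<noteq> {} \<and>
        Y = (\<Union>x\<in>xs - {\<zero>\<^bsub>K\<^esub>}. affine_points K (chart K R xs x)))"

text \<open>Prime divisors are represented by the local rings of their generic points.\<close>

definition prime_divisors :: "('a, 'b) ring_scheme \<Rightarrow> 'a set set \<Rightarrow> 'a set set" where
  "prime_divisors K Y = {E \<in> Y. krull_dim (K \<restriction> E) = 1}"

text \<open>
  The order of a nonzero \<open>f\<close> along \<open>E\<close>, for a discrete valuation ring \<open>E\<close>, and the order of the
  ideal generated by \<open>\<aa>\<close> in \<open>E\<close>.
\<close>

definition ord_along :: "('a, 'b) ring_scheme \<Rightarrow> 'a set \<Rightarrow> 'a \<Rightarrow> int" where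
  "ord_along K E f = (THE z::int. \<exists>t\<in>E. \<exists>u\<in>Units (K \<restriction> E).
     max_ideal (K \<restriction> E) = PIdl\<^bsub>K \<restriction> E\<^esub> t \<and> f = u \<otimes>\<^bsub>K\<^esub> (t [^]\<^bsub>K\<^esub> z))"

definition ideal_ord_along :: "('a, 'b) ring_scheme \<Rightarrow> 'a set \<Rightarrow> 'a set \<Rightarrow> int" where
  "ideal_ord_along K E \<aa> = (THE z. \<exists>g\<in>E - {\<zero>\<^bsub>K\<^esub>}.
     Idl\<^bsub>K \<restriction> E\<^esub> \<aa> = PIdl\<^bsub>K \<restriction> E\<^esub> g \<and> z = ord_along K E g)"


section \<open>Log resolutions\<close>

text \<open>\<open>\<aa>\<O>\<^sub>Y = \<O>\<^sub>Y(-F)\<close> for an effective Cartier divisor \<open>F\<close>:\<close>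

definition invertible_on :: "('a, 'b) ring_scheme \<Rightarrow> 'a set set \<Rightarrow> 'a set \<Rightarrow> bool" where
  "invertible_on K Y \<aa> \<longleftrightarrow>
     (\<forall>A\<in>Y. \<exists>g\<in>A - {\<zero>\<^bsub>K\<^esub>}. Idl\<^bsub>K \<restriction> A\<^esub> \<aa> = PIdl\<^bsub>K \<restriction> A\<^esub> g)"

text \<open>
  The components of \<open>F\<close> and of the exceptional divisor. \<open>Y \<rightarrow> Spec R\<close> is an isomorphism at the
  generic point of a prime divisor \<open>E\<close> iff the local ring \<open>E\<close> is a local ring of \<open>Spec R\<close>.
\<close>

definition log_components ::
    "('a, 'b) ring_scheme \<Rightarrow> 'a set \<Rightarrow> 'a set set \<Rightarrow> 'a set \<Rightarrow> 'a set set" where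
  "log_components K R Y \<aa> =
     {E \<in> prime_divisors K Y. ideal_ord_along K E \<aa> \<noteq> 0 \<or> E \<notin> affine_points K R}"

text \<open>
  At every point \<open>A\<close>, each of the given prime divisors through \<open>A\<close> is cut out by a member of one
  common regular system of parameters; the prime of \<open>A\<close> that defines \<open>E\<close> is \<open>\<mm>\<^sub>E \<inter> A\<close>.
\<close>

definition snc :: "('a, 'b) ring_scheme \<Rightarrow> 'a set set \<Rightarrow> 'a set set \<Rightarrow> bool" where
  "snc K Y D \<longleftrightarrow>
     (\<forall>A\<in>Y. \<exists>ts. regular_parameters (K \<restriction> A) ts \<and>
        (\<forall>E\<in>D. A \<subseteq> E \<longrightarrow> (\<exists>t\<in>set ts. max_ideal (K \<restriction> E) \<inter> A = PIdl\<^bsub>K \<restriction> A\<^esub> t)))"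

definition log_resolution ::
    "('a, 'b) ring_scheme \<Rightarrow> 'a set \<Rightarrow> 'a set \<Rightarrow> 'a set set \<Rightarrow> bool" where
  "log_resolution K R \<aa> Y \<longleftrightarrow>
     projective_birational K R Y \<and> (\<forall>A\<in>Y. regular_local_ring (K \<restriction> A)) \<and>
     invertible_on K Y \<aa> \<and> snc K Y (log_components K R Y \<aa>)"


section \<open>The relative canonical divisor\<close>

definition derivations :: "('a, 'b) ring_scheme \<Rightarrow> 'a set \<Rightarrow> ('a \<Rightarrow> 'a) set" where
  "derivations K k = {D \<in> carrier K \<rightarrow>\<^sub>E carrier K.
     (\<forall>x\<in>carrier K. \<forall>y\<in>carrier K. D (x \<oplus>\<^bsub>K\<^esub> y) = D x \<oplus>\<^bsub>K\<^esub> D y) \<and>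
     (\<forall>x\<in>carrier K. \<forall>y\<in>carrier K. D (x \<otimes>\<^bsub>K\<^esub> y) = x \<otimes>\<^bsub>K\<^esub> D y \<oplus>\<^bsub>K\<^esub> y \<otimes>\<^bsub>K\<^esub> D x) \<and>
     (\<forall>c\<in>k. D c = \<zero>\<^bsub>K\<^esub>)}"

definition derivation_basis ::
    "('a, 'b) ring_scheme \<Rightarrow> 'a set \<Rightarrow> ('a \<Rightarrow> 'a) list \<Rightarrow> bool" where
  "derivation_basis K k Ds \<longleftrightarrow> set Ds \<subseteq> derivations K k \<and>
     (\<forall>D\<in>derivations K k. \<exists>!cs. length cs = length Ds \<and> set cs \<subseteq> carrier K \<and>
        (\<forall>x\<in>carrier K. D x = (\<Oplus>\<^bsub>K\<^esub>i\<in>{..<length Ds}. cs ! i \<otimes>\<^bsub>K\<^esub> (Ds ! i) x)))"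

definition det_in :: "('a, 'b) ring_scheme \<Rightarrow> nat \<Rightarrow> (nat \<Rightarrow> nat \<Rightarrow> 'a) \<Rightarrow> 'a" where
  "det_in K d M = (\<Oplus>\<^bsub>K\<^esub>\<sigma>\<in>{\<sigma>. \<sigma> permutes {..<d}}.
     (if evenperm \<sigma> then \<one>\<^bsub>K\<^esub> else \<ominus>\<^bsub>K\<^esub> \<one>\<^bsub>K\<^esub>) \<otimes>\<^bsub>K\<^esub> (\<Otimes>\<^bsub>K\<^esub>i\<in>{..<d}. M i (\<sigma> i)))"

text \<open>
  Let \<open>D\<^sub>1, \<dots>, D\<^sub>d\<close> be a basis of the \<open>K\<close>-space of \<open>k\<close>-derivations of \<open>K\<close>. A rational top form, an
  element of \<open>\<Lambda>\<^sup>d \<Omega>\<^bsub>K/k\<^esub>\<close>, is identified with its value in \<open>K\<close> on \<open>(D\<^sub>1, \<dots>, D\<^sub>d)\<close>; this sends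
  \<open>da\<^sub>1 \<and> \<dots> \<and> da\<^sub>d\<close> to \<open>det (D\<^sub>i a\<^sub>j)\<close>. If \<open>A\<close> is regular, essentially of finite type over \<open>k\<close>, of
  characteristic zero and with fraction field \<open>K\<close>, then \<open>\<Omega>\<^bsub>A/k\<^esub>\<close> is a projective submodule of
  \<open>\<Omega>\<^bsub>K/k\<^esub>\<close>, and \<open>\<Lambda>\<^sup>d \<Omega>\<^bsub>A/k\<^esub>\<close> becomes the \<open>A\<close>-span of these determinants with all \<open>a\<^sub>j\<close> in \<open>A\<close>.
\<close>

definition wedge_d :: "('a, 'b) ring_scheme \<Rightarrow> ('a \<Rightarrow> 'a) list \<Rightarrow> 'a list \<Rightarrow> 'a" where
  "wedge_d K Ds as = det_in K (length Ds) (\<lambda>i j. (Ds ! i) (as ! j))"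

definition canonical_module ::
    "('a, 'b) ring_scheme \<Rightarrow> ('a \<Rightarrow> 'a) list \<Rightarrow> 'a set \<Rightarrow> 'a set" where
  "canonical_module K Ds A = (\<Union>{ring.Span K A us | us.
     set us \<subseteq> {wedge_d K Ds as | as. length as = length Ds \<and> set as \<subseteq> A}})"

definition canonical_generator ::
    "('a, 'b) ring_scheme \<Rightarrow> ('a \<Rightarrow> 'a) list \<Rightarrow> 'a set \<Rightarrow> 'a \<Rightarrow> bool" where
  "canonical_generator K Ds A g \<longleftrightarrow> g \<in> carrier K - {\<zero>\<^bsub>K\<^esub>} \<and>
     canonical_module K Ds A = {a \<otimes>\<^bsub>K\<^esub> g | a. a \<in> A}"

text \<open>
  The coefficient of \<open>E\<close> in \<open>K\<^sub>Y - \<mu>\<^sup>*K\<^bsub>Spec R\<^esub>\<close>. Take for both canonical divisors the divisor of the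
  rational top form \<open>\<omega>\<close> identified with \<open>1\<close>. If \<open>g\<^sub>E\<close> and \<open>g\<^sub>R\<close> generate the top forms of \<open>E\<close> and
  of \<open>R\<close>, then \<open>\<omega> = g\<^sub>E\<^sup>-\<^sup>1 g\<^sub>E\<close> has order \<open>- ord\<^sub>E g\<^sub>E\<close> along \<open>E\<close>, while \<open>g\<^sub>R\<^sup>-\<^sup>1\<close> is an equation of
  its divisor on \<open>Spec R\<close>.
\<close>

definition relative_canonical_ord ::
    "('a, 'b) ring_scheme \<Rightarrow> 'a set \<Rightarrow> 'a set \<Rightarrow> 'a set \<Rightarrow> int" where
  "relative_canonical_ord K k R E = (THE z. \<exists>Ds g\<^sub>E g\<^sub>R. derivation_basis K k Ds \<and>
     canonical_generator K Ds E g\<^sub>E \<and> canonical_generator K Ds R g\<^sub>R \<and>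
     z = - ord_along K E g\<^sub>E - ord_along K E (inv\<^bsub>K\<^esub> g\<^sub>R))"


section \<open>Multiplier ideals\<close>

text \<open>Global sections of \<open>\<O>\<^sub>Y(K\<^bsub>Y/Spec R\<^esub> - [cF])\<close>, where \<open>\<aa>\<O>\<^sub>Y = \<O>\<^sub>Y(-F)\<close>.\<close>

definition multiplier_sections ::
    "('a, 'b) ring_scheme \<Rightarrow> 'a set \<Rightarrow> 'a set \<Rightarrow> 'a set set \<Rightarrow> rat \<Rightarrow> 'a set \<Rightarrow> 'a set" where
  "multiplier_sections K k R Y c \<aa> = {f \<in> carrier K. f \<noteq> \<zero>\<^bsub>K\<^esub> \<longrightarrow>
     (\<forall>E\<in>prime_divisors K Y.
        ord_along K E f +
          (relative_canonical_ord K k R E - \<lfloor>c * of_int (ideal_ord_along K E \<aa>)\<rfloor>) \<ge> 0)}"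

definition multiplier_ideal ::
    "('a, 'b) ring_scheme \<Rightarrow> 'a set \<Rightarrow> 'a set \<Rightarrow> rat \<Rightarrow> 'a set \<Rightarrow> 'a set" where
  "multiplier_ideal K k R c \<aa> =
     multiplier_sections K k R (SOME Y. log_resolution K R \<aa> Y) c \<aa>"

definition asymptotic_multiplier_ideal ::
    "('a, 'b) ring_scheme \<Rightarrow> 'a set \<Rightarrow> 'a set \<Rightarrow> (real \<Rightarrow> 'a set) \<Rightarrow> real \<Rightarrow> 'a set" where
  "asymptotic_multiplier_ideal K k R \<aa> m =
     (let \<J> = {multiplier_ideal K k R (1 / of_nat p) (\<aa> (real p * m)) | p. p \<ge> 1}
      in THE J. J \<in> \<J> \<and> (\<forall>I\<in>\<J>. J \<subseteq> I \<longrightarrow> I = J))"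


section \<open>Graded families and volumes\<close>

definition primary_to :: "('a, 'b) ring_scheme \<Rightarrow> 'a set \<Rightarrow> 'a set \<Rightarrow> bool" where
  "primary_to A M I \<longleftrightarrow> ideal I A \<and> I \<noteq> carrier A \<and>
     (\<forall>x\<in>carrier A. \<forall>y\<in>carrier A. x \<otimes>\<^bsub>A\<^esub> y \<in> I \<longrightarrow> x \<in> I \<or> (\<exists>r::nat. y [^]\<^bsub>A\<^esub> r \<in> I)) \<and>
     {x \<in> carrier A. \<exists>r::nat. x [^]\<^bsub>A\<^esub> r \<in> I} = M"

text \<open>
  Families are total functions on the reals, of which only the values on \<open>\<Phi>\<close> matter.
\<close>

definition graded_family :: "('a, 'b) ring_scheme \<Rightarrow> real set \<Rightarrow> (real \<Rightarrow> 'a set) \<Rightarrow> bool" where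
  "graded_family A \<Phi> \<aa> \<longleftrightarrow>
     (\<forall>m\<in>\<Phi>. if m = 0 then \<aa> m = carrier A else primary_to A (max_ideal A) (\<aa> m)) \<and>
     (\<forall>m\<in>\<Phi>. \<forall>l\<in>\<Phi>. \<aa> m \<cdot>\<^bsub>A\<^esub> \<aa> l \<subseteq> \<aa> (m + l))"

definition volume ::
    "('a, 'b) ring_scheme \<Rightarrow> nat \<Rightarrow> real set \<Rightarrow> (real \<Rightarrow> 'a set) \<Rightarrow> ennreal" where
  "volume A n \<Phi> \<aa> = Limsup (inf at_top (principal \<Phi>))
     (\<lambda>m. ennreal_of_enat (ring_length (A Quot (\<aa> m))) / ennreal (m ^ n / fact n))"

definition ennreal_root :: "nat \<Rightarrow> ennreal \<Rightarrow> ennreal" where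
  "ennreal_root n x = (if x = \<infinity> then \<infinity> else ennreal (root n (enn2real x)))"

end

theory Submission
  imports Defs
begin

text \<open>
  The inequality holds already for each single index: if \<open>\<mm>\<close> is generated by \<open>n\<close> elements and
  \<open>I\<close>, \<open>J\<close> are \<open>\<mm>\<close>-primary, then
  \<open>length (R/IJ)\<^sup>1\<^sup>/\<^sup>n \<le> length (R/I)\<^sup>1\<^sup>/\<^sup>n + length (R/J)\<^sup>1\<^sup>/\<^sup>n\<close>.

  Filtering \<open>R\<close> by monomials in the generators, \<open>length (R/I)\<close> is the number of exponents outside
  a set \<open>S(I) \<subseteq> \<nat>\<^sup>n\<close> of leading exponents, which is closed upwards, and \<open>S(I) + S(J) \<subseteq> S(IJ)\<close>.
  It remains to bound the covolume of a sumset of upward closed sets. Let \<open>a\<close>, \<open>b\<close>, \<open>c\<close> be the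
  heights of the complements of \<open>S\<close>, \<open>T\<close>, \<open>S + T\<close> over \<open>\<nat>\<^sup>n\<^sup>-\<^sup>1\<close>, so that
  \<open>c (y + z) \<le> a y + b z\<close>. Taking \<open>z = \<lambda> y\<close> and summing over \<open>y\<close> gives
  \<open>X \<le> (1 + \<lambda>)\<^sup>n\<^sup>-\<^sup>1 V + (1 + 1/\<lambda>)\<^sup>n\<^sup>-\<^sup>1 W\<close> for the three covolumes; \<open>\<lambda> = (W/V)\<^sup>1\<^sup>/\<^sup>n\<close> is optimal
  and gives \<open>X\<^sup>1\<^sup>/\<^sup>n \<le> V\<^sup>1\<^sup>/\<^sup>n + W\<^sup>1\<^sup>/\<^sup>n\<close>.
\<close>

no_notation Sum_Type.Plus (infixr \<open><+>\<close> 65)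

section \<open>Covolumes of upward closed sets of exponents\<close>

text \<open>Points are functions on all of \<open>nat\<close> that vanish from \<open>d\<close> on,
  so boxes of all dimensions share one type and \<open>y(d := x)\<close> adds a coordinate.\<close>

definition box :: "nat \<Rightarrow> nat \<Rightarrow> (nat \<Rightarrow> nat) set" where
  "box d L = {y. (\<forall>i<d. y i < L) \<and> (\<forall>i\<ge>d. y i = 0)}"

lemma bij_betw_box_Suc:
  "bij_betw (\<lambda>(y, x). y(d := x)) (box d L \<times> {..<L}) (box (Suc d) L)"
  by (rule bij_betw_byWitness[where f' = "\<lambda>u. (u(d := 0), u d)"])
    (auto simp: box_def fun_eq_iff less_Suc_eq)

lemma box_0: "box 0 L = {\<lambda>_. 0}"
  by (auto simp: box_def)

lemma finite_card_box: "finite (box d L) \<and> card (box d L) = L ^ d"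
proof (induction d)
  case 0
  then show ?case by (simp add: box_0)
next
  case (Suc d)
  then have "finite (box d L \<times> {..<L})" "card (box d L \<times> {..<L}) = L ^ Suc d"
    by (auto simp: card_cartesian_product)
  with bij_betw_box_Suc[of d L] show ?case
    by (metis bij_betw_finite bij_betw_same_card)
qed

lemmas finite_box [simp] = finite_card_box[THEN conjunct1]
  and card_box = finite_card_box[THEN conjunct2]

text \<open>Division with remainder cuts \<open>box d (k * L)\<close> into cubes of
  \<open>k ^ d\<close> points, one for each point of \<open>box d L\<close>; the summand is constant
  on each cube.\<close>

lemma sum_box_div:
  fixes f :: "(nat \<Rightarrow> nat) \<Rightarrow> nat"
  assumes "k > 0"
  shows "(\<Sum>u\<in>box d (k * L). f (\<lambda>i. u i div k)) = k ^ d * (\<Sum>y\<in>box d L. f y)"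
proof -
  have lt: "k * a + b < k * L" if "a < L" "b < k" for a b
  proof -
    have "k * a + b < k * Suc a" using that by simp
    also have "\<dots> \<le> k * L" using that by (intro mult_left_mono) auto
    finally show ?thesis .
  qed
  have "bij_betw (\<lambda>(y, v). \<lambda>i. k * y i + v i) (box d L \<times> box d k) (box d (k * L))"
  proof (rule bij_betw_byWitness[where f' = "\<lambda>u. (\<lambda>i. u i div k, \<lambda>i. u i mod k)"])
    have less: "v i < k" if "v \<in> box d k" for v i
      using that assms by (cases "i < d") (auto simp: box_def)
    show "\<forall>yv\<in>box d L \<times> box d k.
        (case case yv of (y, v) \<Rightarrow> \<lambda>i. k * y i + v i of u \<Rightarrow> (\<lambda>i. u i div k, \<lambda>i. u i mod k)) = yv"
      using assms by (auto simp: fun_eq_iff less)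
    show "(\<lambda>(y, v) i. k * y i + v i) ` (box d L \<times> box d k) \<subseteq> box d (k * L)"
      by (auto simp: box_def lt)
    show "(\<lambda>u. (\<lambda>i. u i div k, \<lambda>i. u i mod k)) ` box d (k * L) \<subseteq> box d L \<times> box d k"
      using assms by (auto simp: box_def less_mult_imp_div_less mult.commute)
  qed (auto simp: fun_eq_iff)
  then have "(\<Sum>u\<in>box d (k * L). f (\<lambda>i. u i div k))
      = (\<Sum>(y, v)\<in>box d L \<times> box d k. f (\<lambda>i. (k * y i + v i) div k))"
    by (subst sum.reindex_bij_betw[symmetric, where g = "\<lambda>u. f (\<lambda>i. u i div k)"])
      (auto simp: case_prod_unfold)
  also have "\<dots> = (\<Sum>(y, v)\<in>box d L \<times> box d k. f y)"
  proof (rule sum.cong[OF refl], clarify)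
    fix y v assume "v \<in> box d k"
    then have "v i < k" for i
      using assms by (cases "i < d") (auto simp: box_def)
    then show "f (\<lambda>i. (k * y i + v i) div k) = f y"
      using assms by simp
  qed
  also have "\<dots> = k ^ d * (\<Sum>y\<in>box d L. f y)"
    by (simp add: sum.cartesian_product[symmetric] card_box sum_distrib_left)
  finally show ?thesis .
qed

text \<open>The two summands are sampled at points proportional to \<open>q\<close> and \<open>p\<close>; the floors cause
  no error because \<open>\<lfloor>s\<rfloor> + \<lfloor>t\<rfloor> \<le> \<lfloor>s + t\<rfloor>\<close>.\<close>

lemma sum_box_scaled:
  fixes a b c :: "(nat \<Rightarrow> nat) \<Rightarrow> nat"
  assumes abc: "\<And>y z r. (\<And>i. y i + z i \<le> r i) \<Longrightarrow> c r \<le> a y + b z"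
    and "p > 0" "q > 0"
  shows "(p * q) ^ d * (\<Sum>y\<in>box d L. c y)
    \<le> (q * (p + q)) ^ d * (\<Sum>y\<in>box d L. a y) + (p * (p + q)) ^ d * (\<Sum>y\<in>box d L. b y)"
proof -
  have mono: "box d M \<subseteq> box d N" if "M \<le> N" for M N
    using that by (auto simp: box_def)
  \<comment> \<open>The integer form of 1/(q(p+q)) + 1/(p(p+q)) = 1/(pq).\<close>
  have floors: "u div (q * (p + q)) + u div (p * (p + q)) \<le> u div (p * q)" for u :: nat
  proof -
    define y z where "y = u div (q * (p + q))" and "z = u div (p * (p + q))"
    have "y * (q * (p + q)) \<le> u" "z * (p * (p + q)) \<le> u"
      by (simp_all add: y_def z_def)
    then have "p * (y * (q * (p + q))) + q * (z * (p * (p + q))) \<le> p * u + q * u"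
      by (intro add_mono mult_left_mono) auto
    then have "(p + q) * ((y + z) * (p * q)) \<le> (p + q) * u"
      by (simp add: algebra_simps)
    then have "(y + z) * (p * q) \<le> u"
      using assms by simp
    then show ?thesis
      using assms by (simp add: less_eq_div_iff_mult_less_eq y_def z_def)
  qed
  have "(p * q) ^ d * (\<Sum>y\<in>box d L. c y) = (\<Sum>u\<in>box d (p * q * L). c (\<lambda>i. u i div (p * q)))"
    using assms by (simp add: sum_box_div)
  also have "\<dots> \<le> (\<Sum>u\<in>box d (p * q * L).
      a (\<lambda>i. u i div (q * (p + q))) + b (\<lambda>i. u i div (p * (p + q))))"
    by (intro sum_mono abc floors)
  also have "\<dots> = (\<Sum>u\<in>box d (p * q * L). a (\<lambda>i. u i div (q * (p + q))))
      + (\<Sum>u\<in>box d (p * q * L). b (\<lambda>i. u i div (p * (p + q))))"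
    by (rule sum.distrib)
  \<comment> \<open>Each box is enlarged until its side is \<open>L\<close> times the divisor
    occurring in its sum, the form that \<open>sum_box_div\<close> evaluates.\<close>
  also have "\<dots> \<le> (\<Sum>u\<in>box d (q * (p + q) * L). a (\<lambda>i. u i div (q * (p + q))))
      + (\<Sum>u\<in>box d (p * (p + q) * L). b (\<lambda>i. u i div (p * (p + q))))"
    by (intro add_mono sum_mono2 mono finite_box) (auto simp: algebra_simps)
  also have "\<dots> = (q * (p + q)) ^ d * (\<Sum>y\<in>box d L. a y) + (p * (p + q)) ^ d * (\<Sum>y\<in>box d L. b y)"
    using assms by (simp add: sum_box_div)
  finally show ?thesis .
qed

text \<open>The hypothesis is best when p : q is the ratio of the roots of \<open>V\<close> and
  \<open>W\<close>. That ratio may be irrational or degenerate, so rationals \<open>s\<close>,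
  \<open>t\<close> slightly above the roots replace them; the bound on \<open>Z\<close> then becomes
  \<open>(s + t) ^ Suc d\<close>.\<close>

lemma root_le_root_add_rootI:
  fixes V W Z d :: nat
  assumes le: "\<And>p q :: nat. p > 0 \<Longrightarrow> q > 0 \<Longrightarrow>
    (p * q) ^ d * Z \<le> (q * (p + q)) ^ d * V + (p * (p + q)) ^ d * W"
  shows "root (Suc d) Z \<le> root (Suc d) V + root (Suc d) W"
proof (rule field_le_epsilon)
  fix e :: real assume "e > 0"
  define v w where "v = root (Suc d) V" and "w = root (Suc d) W"
  have "v \<ge> 0" "w \<ge> 0" by (auto simp: v_def w_def)
  obtain s where s: "s \<in> \<rat>" "v < s" "s < v + e / 2"
    using Rats_dense_in_real[of v "v + e / 2"] \<open>e > 0\<close> by auto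
  obtain t where t: "t \<in> \<rat>" "w < t" "t < w + e / 2"
    using Rats_dense_in_real[of w "w + e / 2"] \<open>e > 0\<close> by auto
  have "s > 0" "t > 0" using s t \<open>v \<ge> 0\<close> \<open>w \<ge> 0\<close> by linarith+
  obtain i j where ij: "j \<noteq> 0" "\<bar>s\<bar> = real i / real j" by (rule Rats_abs_nat_div_natE[OF s(1)])
  obtain k l where kl: "l \<noteq> 0" "\<bar>t\<bar> = real k / real l" by (rule Rats_abs_nat_div_natE[OF t(1)])
  \<comment> \<open>Over the common denominator \<open>D\<close>, these are the numerators of
    \<open>s\<close> and \<open>t\<close>.\<close>
  define p q where "p = i * l" and "q = k * j"
  define D where "D = real (j * l)"
  have D: "D > 0" using ij kl by (simp add: D_def)
  have p: "real p = s * D" and q: "real q = t * D"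
    using ij kl \<open>s > 0\<close> \<open>t > 0\<close> by (auto simp: p_def q_def D_def)
  have "p > 0" "q > 0"
    using p q D \<open>s > 0\<close> \<open>t > 0\<close> by (metis mult_pos_pos of_nat_0_less_iff)+
  from le[OF this] have "real ((p * q) ^ d * Z) \<le> real ((q * (p + q)) ^ d * V + (p * (p + q)) ^ d * W)"
    by (rule of_nat_mono)
  moreover have "real p * real q = s * t * (D * D)" "real q * (real p + real q) = t * (s + t) * (D * D)"
      "real p * (real p + real q) = s * (s + t) * (D * D)"
    by (simp_all add: p q algebra_simps)
  ultimately have "(s * t * (D * D)) ^ d * real Z
      \<le> (t * (s + t) * (D * D)) ^ d * real V + (s * (s + t) * (D * D)) ^ d * real W"
    by simp
  then have "(s * t) ^ d * real Z * (D * D) ^ d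
      \<le> ((t * (s + t)) ^ d * real V + (s * (s + t)) ^ d * real W) * (D * D) ^ d"
    unfolding power_mult_distrib[of _ "D * D"] distrib_right by (simp only: mult_ac)
  then have "(s * t) ^ d * real Z \<le> (t * (s + t)) ^ d * real V + (s * (s + t)) ^ d * real W"
    using D by (simp only: mult_le_cancel_right) auto
  also have "\<dots> \<le> (t * (s + t)) ^ d * s ^ Suc d + (s * (s + t)) ^ d * t ^ Suc d"
  proof (intro add_mono mult_left_mono)
    have "real V = v ^ Suc d" "real W = w ^ Suc d"
      by (simp_all add: v_def w_def del: power_Suc)
    then show "real V \<le> s ^ Suc d" "real W \<le> t ^ Suc d"
      using s t \<open>v \<ge> 0\<close> \<open>w \<ge> 0\<close> by (simp_all add: power_mono del: power_Suc)
  qed (use \<open>s > 0\<close> \<open>t > 0\<close> in auto)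
  also have "\<dots> = (s * t) ^ d * (s + t) ^ Suc d"
    unfolding power_mult_distrib power_Suc distrib_right[of s t "(s + t) ^ d"]
    by (simp only: distrib_left mult_ac)
  finally have "real Z \<le> (s + t) ^ Suc d"
    using \<open>s > 0\<close> \<open>t > 0\<close> by (simp add: mult_le_cancel_left del: power_Suc)
  then have "root (Suc d) Z \<le> root (Suc d) ((s + t) ^ Suc d)"
    by (rule real_root_le_mono[rotated]) simp
  also have "\<dots> = s + t"
    using \<open>s > 0\<close> \<open>t > 0\<close> by (intro real_root_power_cancel) auto
  also have "\<dots> \<le> v + w + e"
    using s t by linarith
  finally show "root (Suc d) Z \<le> root (Suc d) V + root (Suc d) W + e"
    by (simp add: v_def w_def)
qed

text \<open>By the second clause, exponents supported on \<open>{..<n}\<close> and missing from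
  \<open>S\<close> all lie in \<open>box n L\<close>, so \<open>card (box n L - S)\<close> is the
  full covolume.\<close>

definition upset :: "nat \<Rightarrow> nat \<Rightarrow> (nat \<Rightarrow> nat) set \<Rightarrow> bool" where
  "upset n L S \<longleftrightarrow> (\<forall>\<alpha> \<beta>. \<alpha> \<in> S \<longrightarrow> \<alpha> \<le> \<beta> \<longrightarrow> \<beta> \<in> S) \<and> (\<forall>\<alpha>. \<forall>i<n. L \<le> \<alpha> i \<longrightarrow> \<alpha> \<in> S)"

lemma upsetD: "upset n L S \<Longrightarrow> \<alpha> \<in> S \<Longrightarrow> \<alpha> \<le> \<beta> \<Longrightarrow> \<beta> \<in> S"
  by (auto simp: upset_def)

lemma upset_outside: "upset n L S \<Longrightarrow> i < n \<Longrightarrow> L \<le> \<alpha> i \<Longrightarrow> \<alpha> \<in> S"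
  by (auto simp: upset_def)

text \<open>On the line through \<open>y\<close> in direction \<open>d\<close>, membership in
  \<open>S\<close> persists upwards and holds at height \<open>L\<close>; so the
  \<open>LEAST\<close> exists and is the height of the complement over \<open>y\<close>.\<close>

lemma upset_slice_iff:
  assumes "upset (Suc d) L S"
  shows "x < (LEAST x. y(d := x) \<in> S) \<longleftrightarrow> y(d := x) \<notin> S"
proof
  have "y(d := L) \<in> S"
    using assms by (rule upset_outside[where i = d]) auto
  then have *: "y(d := (LEAST x. y(d := x) \<in> S)) \<in> S"
    by (rule LeastI)
  show "x < (LEAST x. y(d := x) \<in> S)" if "y(d := x) \<notin> S"
  proof (rule ccontr)
    assume "\<not> x < (LEAST x. y(d := x) \<in> S)"
    then have "y(d := (LEAST x. y(d := x) \<in> S)) \<le> y(d := x)"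
      by (auto simp: le_fun_def)
    with assms * have "y(d := x) \<in> S" by (rule upsetD)
    with that show False ..
  qed
qed (rule not_less_Least)

text \<open>The complement is counted in columns; none is higher than \<open>L\<close>, so the box
  cuts nothing off.\<close>

lemma card_box_diff_upset:
  assumes "upset (Suc d) L S"
  shows "card (box (Suc d) L - S) = (\<Sum>y\<in>box d L. LEAST x. y(d := x) \<in> S)"
proof -
  let ?f = "\<lambda>y. LEAST x. y(d := x) \<in> S"
  have le: "?f y \<le> L" for y
    by (rule Least_le, rule upset_outside[OF assms, where i = d]) auto
  have bij: "bij_betw (\<lambda>(y, x). y(d := x)) (SIGMA y:box d L. {..<?f y}) (box (Suc d) L - S)"
  proof (rule bij_betw_byWitness[where f' = "\<lambda>u. (u(d := 0), u d)"])
    show "(\<lambda>(y, x). y(d := x)) ` (SIGMA y:box d L. {..<?f y}) \<subseteq> box (Suc d) L - S"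
    proof clarsimp
      fix y x assume y: "y \<in> box d L" and x: "x < ?f y"
      have "x < L" using x le[of y] by linarith
      with y have "y(d := x) \<in> box (Suc d) L"
        by (auto simp: box_def less_Suc_eq)
      with x show "y(d := x) \<in> box (Suc d) L \<and> y(d := x) \<notin> S"
        by (simp add: upset_slice_iff[OF assms])
    qed
    show "(\<lambda>u. (u(d := 0), u d)) ` (box (Suc d) L - S) \<subseteq> (SIGMA y:box d L. {..<?f y})"
      using upset_slice_iff[OF assms, of _ "_(d := 0)"] by (auto simp: box_def)
  qed (auto simp: box_def fun_eq_iff)
  show ?thesis
    by (simp flip: bij_betw_same_card[OF bij])
qed

text \<open>The lowest members of the columns over \<open>y\<close> and \<open>z\<close> add up to a
  member of \<open>U\<close>, which upward closure moves over \<open>r\<close>. This gives the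
  subadditivity of heights that \<open>sum_box_scaled\<close> asks for.\<close>

lemma covolume_sumset_le:
  assumes "upset (Suc d) L S" "upset (Suc d) L T" "upset (Suc d) L U"
    and sum: "\<And>\<alpha> \<beta>. \<alpha> \<in> S \<Longrightarrow> \<beta> \<in> T \<Longrightarrow> (\<lambda>i. \<alpha> i + \<beta> i) \<in> U"
  shows "root (Suc d) (card (box (Suc d) L - U))
    \<le> root (Suc d) (card (box (Suc d) L - S)) + root (Suc d) (card (box (Suc d) L - T))"
  unfolding card_box_diff_upset[OF assms(1)] card_box_diff_upset[OF assms(2)]
    card_box_diff_upset[OF assms(3)]
proof (intro root_le_root_add_rootI sum_box_scaled)
  fix y z r :: "nat \<Rightarrow> nat"
  let ?a = "LEAST x. y(d := x) \<in> S" and ?b = "LEAST x. z(d := x) \<in> T"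
  assume le: "\<And>i. y i + z i \<le> r i"
  have "y(d := ?a) \<in> S" "z(d := ?b) \<in> T"
    using upset_slice_iff[OF assms(1), of ?a y] upset_slice_iff[OF assms(2), of ?b z] by simp_all
  from sum[OF this] have "r(d := ?a + ?b) \<in> U"
    by (rule upsetD[OF assms(3)]) (use le in \<open>auto simp: le_fun_def\<close>)
  then show "(LEAST x. r(d := x) \<in> U) \<le> ?a + ?b"
    by (rule Least_le)
qed

section \<open>Lengths and monomial filtrations\<close>

lemma (in ring) ideal_add_memI1: "ideal I R \<Longrightarrow> ideal J R \<Longrightarrow> a \<in> I \<Longrightarrow> a \<in> I <+> J"
  using union_genideal[of I J] genideal_self[of "I \<union> J"] ideal.Icarr[of I R] ideal.Icarr[of J R]
  by blast

lemma (in ring) ideal_add_memI2: "ideal I R \<Longrightarrow> ideal J R \<Longrightarrow> a \<in> J \<Longrightarrow> a \<in> I <+> J"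
  using union_genideal[of I J] genideal_self[of "I \<union> J"] ideal.Icarr[of I R] ideal.Icarr[of J R]
  by blast

lemma (in ring) ideal_add_memE:
  assumes "a \<in> I <+> J"
  obtains i j where "i \<in> I" "j \<in> J" "a = i \<oplus> j"
  using assms by (auto simp: set_add_def')

lemma (in ring) ideal_add_closed: "ideal I R \<Longrightarrow> a \<in> I \<Longrightarrow> b \<in> I \<Longrightarrow> a \<oplus> b \<in> I"
  by (rule additive_subgroup.a_closed[OF ideal.axioms(1)])

lemma (in ring) ideal_minus_closed: "ideal I R \<Longrightarrow> a \<in> I \<Longrightarrow> b \<in> I \<Longrightarrow> a \<ominus> b \<in> I"
  unfolding a_minus_def
  by (intro ideal_add_closed additive_subgroup.a_inv_closed[OF ideal.axioms(1)])

lemma (in ring) ideal_add_subset: "ideal L R \<Longrightarrow> I \<subseteq> L \<Longrightarrow> J \<subseteq> L \<Longrightarrow> I <+> J \<subseteq> L"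
  by (auto elim!: ideal_add_memE intro!: ideal_add_closed)

text \<open>Maximality makes \<open>PIdl c <+> M\<close> the whole ring. This serves to divide by a
  leading coefficient outside \<open>M\<close>.\<close>

lemma (in cring) maximalideal_unit_mod:
  assumes "maximalideal M R" "c \<in> carrier R" "c \<notin> M"
  obtains r \<mu> where "r \<in> carrier R" "\<mu> \<in> M" "\<one> = r \<otimes> c \<oplus> \<mu>"
proof -
  interpret maximalideal M R by fact
  have ideals: "ideal (PIdl c) R" "ideal M R"
    using assms cgenideal_ideal is_ideal by auto
  have "ideal (PIdl c <+> M) R"
    by (intro add_ideals ideals)
  moreover have "M \<subseteq> PIdl c <+> M" "c \<in> PIdl c <+> M"
    using ideal_add_memI1[OF ideals] ideal_add_memI2[OF ideals] cgenideal_self assms by blast+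
  moreover have "PIdl c <+> M \<subseteq> carrier R"
    using ideal.Icarr[OF \<open>ideal (PIdl c <+> M) R\<close>] by blast
  ultimately have "PIdl c <+> M = carrier R"
    using I_maximal assms by blast
  then have "\<one> \<in> PIdl c <+> M" by simp
  then show ?thesis
    by (auto simp: cgenideal_def elim!: ideal_add_memE intro: that)
qed

text \<open>\<open>N\<close> has two roles: the \<open>N\<close>-th powers of the generators will
  lie in the ideals considered, and \<open>N\<close> is the base of the weights.\<close>

locale monomials = cring R for R (structure) +
  fixes x :: "nat \<Rightarrow> 'a" and n N :: nat and M :: "'a set"
  assumes x_closed: "x \<in> {..<n} \<rightarrow> carrier R"
    and M_eq: "M = Idl (x ` {..<n})" and maximal: "maximalideal M R"
    and N_pos: "N > 0"
begin

definition mon :: "(nat \<Rightarrow> nat) \<Rightarrow> 'a" where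
  "mon \<alpha> = (\<Otimes>i\<in>{..<n}. x i [^] \<alpha> i)"

text \<open>On \<open>box n N\<close> the weight is injective, so that it plays the role of a monomial order.\<close>

definition weight :: "(nat \<Rightarrow> nat) \<Rightarrow> nat" where
  "weight \<alpha> = (\<Sum>i<n. \<alpha> i * N ^ i)"

definition filt :: "nat \<Rightarrow> 'a set" where
  "filt k = Idl {mon \<alpha> |\<alpha>. k \<le> weight \<alpha>}"

text \<open>The exponents \<open>\<alpha>\<close> for which \<open>I + filt (weight \<alpha>)\<close> and \<open>I + filt (weight \<alpha> + 1)\<close>
  agree; elsewhere the quotient is one-dimensional over \<open>R / M\<close>.\<close>

definition exps :: "'a set \<Rightarrow> (nat \<Rightarrow> nat) set" where
  "exps I = {\<alpha>. mon \<alpha> \<in> I <+> filt (Suc (weight \<alpha>))}"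

text \<open>Such an ideal contains every monomial with some exponent at least \<open>N\<close>,
  which leaves only the exponents in \<open>box n N\<close> to be examined.\<close>

definition bounded_ideal :: "'a set \<Rightarrow> bool" where
  "bounded_ideal I \<longleftrightarrow> ideal I R \<and> (\<forall>i<n. x i [^] N \<in> I)"

section \<open>Monomials and injectivity of the weight\<close>

lemma mon_closed [simp]: "mon \<alpha> \<in> carrier R"
  unfolding mon_def using x_closed by (intro finprod_closed) auto

lemma mon_add: "mon (\<lambda>i. \<alpha> i + \<beta> i) = mon \<alpha> \<otimes> mon \<beta>"
proof -
  have "mon (\<lambda>i. \<alpha> i + \<beta> i) = (\<Otimes>i\<in>{..<n}. x i [^] \<alpha> i \<otimes> x i [^] \<beta> i)"
    unfolding mon_def using x_closed by (intro finprod_cong) (auto simp: nat_pow_mult Pi_iff simp_implies_def)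
  also have "\<dots> = mon \<alpha> \<otimes> mon \<beta>"
    unfolding mon_def using x_closed by (intro finprod_multf) auto
  finally show ?thesis .
qed

lemma mon_cong: "(\<And>i. i < n \<Longrightarrow> \<alpha> i = \<beta> i) \<Longrightarrow> mon \<alpha> = mon \<beta>"
  unfolding mon_def using x_closed by (intro finprod_cong) (auto simp: simp_implies_def)

lemma mon_single: "i < n \<Longrightarrow> mon (\<lambda>j. if j = i then m else 0) = x i [^] m"
proof -
  assume "i < n"
  have "mon (\<lambda>j. if j = i then m else 0) = (\<Otimes>j\<in>{..<n}. if i = j then x j [^] m else \<one>)"
    unfolding mon_def using x_closed by (intro finprod_cong) (auto simp: simp_implies_def)
  also have "\<dots> = x i [^] m"
    using x_closed \<open>i < n\<close> by (intro finprod_singleton) auto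
  finally show ?thesis .
qed

lemma mon_zero: "mon (\<lambda>_. 0) = \<one>"
  by (simp add: mon_def)

lemma weight_add: "weight (\<lambda>i. \<alpha> i + \<beta> i) = weight \<alpha> + weight \<beta>"
  by (simp add: weight_def sum.distrib algebra_simps)

lemma weight_cong: "(\<And>i. i < n \<Longrightarrow> \<alpha> i = \<beta> i) \<Longrightarrow> weight \<alpha> = weight \<beta>"
  by (simp add: weight_def)

lemma digit_sum_less: "(\<And>i. i < m \<Longrightarrow> \<alpha> i < N) \<Longrightarrow> (\<Sum>i<m. \<alpha> i * N ^ i) < N ^ m"
proof (induction m)
  case (Suc m)
  then have "(\<Sum>i<m. \<alpha> i * N ^ i) < N ^ m" by simp
  then have "(\<Sum>i<Suc m. \<alpha> i * N ^ i) < Suc (\<alpha> m) * N ^ m" by simp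
  also have "\<dots> \<le> N * N ^ m"
    using Suc.prems[of m] by (intro mult_right_mono) auto
  finally show ?case by simp
qed simp

lemma digit_sum_inj:
  assumes "\<And>i. i < m \<Longrightarrow> \<alpha> i < N" "\<And>i. i < m \<Longrightarrow> \<beta> i < N"
    and "(\<Sum>i<m. \<alpha> i * N ^ i) = (\<Sum>i<m. \<beta> i * N ^ i)" "i < m"
  shows "\<alpha> i = \<beta> i"
  using assms
proof (induction m arbitrary: i)
  case (Suc m)
  have *: "(\<Sum>i<m. \<alpha> i * N ^ i) < N ^ m" "(\<Sum>i<m. \<beta> i * N ^ i) < N ^ m"
    using Suc.prems by (auto intro!: digit_sum_less)
  have eq: "(\<Sum>i<m. \<alpha> i * N ^ i) + N ^ m * \<alpha> m = (\<Sum>i<m. \<beta> i * N ^ i) + N ^ m * \<beta> m"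
    using Suc.prems(3) by (simp add: mult.commute)
  from arg_cong[OF this, of "\<lambda>s. s div N ^ m"] have "\<alpha> m = \<beta> m"
    using * N_pos by simp
  with eq have "(\<Sum>i<m. \<alpha> i * N ^ i) = (\<Sum>i<m. \<beta> i * N ^ i)" by simp
  then have "i < m \<Longrightarrow> \<alpha> i = \<beta> i"
    using Suc.prems by (intro Suc.IH) auto
  with \<open>\<alpha> m = \<beta> m\<close> Suc.prems(4) show ?case
    by (cases "i = m") auto
qed simp

lemma weight_less: "\<alpha> \<in> box n N \<Longrightarrow> weight \<alpha> < N ^ n"
  unfolding weight_def by (rule digit_sum_less) (auto simp: box_def)

lemma weight_inj_on: "inj_on weight (box n N)"
proof (rule inj_onI)
  fix \<alpha> \<beta> assume *: "\<alpha> \<in> box n N" "\<beta> \<in> box n N" "weight \<alpha> = weight \<beta>"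
  then have "\<alpha> i = \<beta> i" if "i < n" for i
    using that by (intro digit_sum_inj[of n \<alpha> \<beta>]) (auto simp: weight_def box_def)
  with * show "\<alpha> = \<beta>"
    by (auto simp: box_def fun_eq_iff) (metis not_less)
qed

section \<open>The filtration by weight\<close>

lemma filt_ideal [simp]: "ideal (filt k) R"
  unfolding filt_def by (rule genideal_ideal) auto

lemma filt_closed: "a \<in> filt k \<Longrightarrow> a \<in> carrier R"
  by (rule ideal.Icarr[OF filt_ideal])

lemma mon_in_filt: "k \<le> weight \<alpha> \<Longrightarrow> mon \<alpha> \<in> filt k"
  unfolding filt_def using genideal_self[of "{mon \<beta> |\<beta>. k \<le> weight \<beta>}"] mon_closed by blast

lemma filt_le: "ideal J R \<Longrightarrow> (\<And>\<alpha>. k \<le> weight \<alpha> \<Longrightarrow> mon \<alpha> \<in> J) \<Longrightarrow> filt k \<subseteq> J"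
  unfolding filt_def by (rule genideal_minimal) auto

lemma filt_antimono: "k \<le> l \<Longrightarrow> filt l \<subseteq> filt k"
  by (rule filt_le) (auto intro: mon_in_filt)

lemma filt_0: "filt 0 = carrier R"
  using mon_in_filt[of 0 "\<lambda>_. 0"] ideal.one_imp_carrier[OF filt_ideal] by (simp add: mon_zero)

text \<open>The colon ideal of \<open>J\<close> by \<open>a\<close>. With \<open>filt_le\<close> it
  reduces a claim about products with \<open>a\<close> to the monomials that generate
  \<open>filt k\<close>.\<close>

lemma ideal_colon:
  assumes "ideal J R" "a \<in> carrier R"
  shows "ideal {b \<in> carrier R. a \<otimes> b \<in> J} R"
proof (rule idealI[OF ring_axioms])
  interpret ideal J R by fact
  show "subgroup {b \<in> carrier R. a \<otimes> b \<in> J} (add_monoid R)"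
  proof (rule subgroup.intro)
    fix b assume b: "b \<in> {b \<in> carrier R. a \<otimes> b \<in> J}"
    have "inv\<^bsub>add_monoid R\<^esub> b = \<ominus> b" by (simp add: a_inv_def)
    with b assms(2) show "inv\<^bsub>add_monoid R\<^esub> b \<in> {b \<in> carrier R. a \<otimes> b \<in> J}"
      by (simp add: r_minus)
  qed (use assms(2) in \<open>auto simp: r_distr\<close>)
next
  interpret ideal J R by fact
  fix b c assume b: "b \<in> {b \<in> carrier R. a \<otimes> b \<in> J}" and c: "c \<in> carrier R"
  have "a \<otimes> (c \<otimes> b) = c \<otimes> (a \<otimes> b)" "a \<otimes> (b \<otimes> c) = c \<otimes> (a \<otimes> b)"
    using b c assms(2) by (auto simp: m_ac)
  then show "c \<otimes> b \<in> {b \<in> carrier R. a \<otimes> b \<in> J}" "b \<otimes> c \<in> {b \<in> carrier R. a \<otimes> b \<in> J}"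
    using b c by (auto intro: I_l_closed)
qed

text \<open>Weights of monomials add up; colon ideals pass from monomials to arbitrary elements,
  first in the right factor and then in the left.\<close>

lemma filt_mult:
  assumes "a \<in> filt k" "b \<in> filt l"
  shows "a \<otimes> b \<in> filt (k + l)"
proof -
  have 1: "mon \<alpha> \<otimes> b' \<in> filt (k + l)" if "k \<le> weight \<alpha>" "b' \<in> filt l" for \<alpha> b'
  proof -
    have "filt l \<subseteq> {b \<in> carrier R. mon \<alpha> \<otimes> b \<in> filt (k + l)}"
      using that
      by (intro filt_le ideal_colon) (auto simp: mon_add[symmetric] weight_add intro!: mon_in_filt)
    with that show ?thesis by blast
  qed
  have b: "b \<in> carrier R" using assms filt_closed by blast
  have "filt k \<subseteq> {a \<in> carrier R. b \<otimes> a \<in> filt (k + l)}"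
    using 1 assms b by (intro filt_le ideal_colon) (auto simp: m_comm[of b])
  with assms b show ?thesis using filt_closed[OF assms(1)] by (auto simp: m_comm)
qed

text \<open>Each generator is a monomial of weight \<open>N ^ i\<close>, which is positive. Hence
  multiplication by \<open>M\<close> raises the filtration, and coefficients matter only modulo
  \<open>M\<close> in each step.\<close>

lemma M_subset_filt: "M \<subseteq> filt 1"
  unfolding M_eq
proof (rule genideal_minimal)
  show "x ` {..<n} \<subseteq> filt 1"
  proof clarify
    fix i assume "i < n"
    let ?e = "\<lambda>j. if j = i then 1 else 0 :: nat"
    have "weight ?e = N ^ i"
      using \<open>i < n\<close> by (simp add: weight_def if_distrib[of "\<lambda>c. c * _"] sum.delta cong: if_cong)
    then have "mon ?e \<in> filt 1"
      using N_pos by (intro mon_in_filt) (simp add: Suc_le_eq)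
    then show "x i \<in> filt 1"
      using mon_single[OF \<open>i < n\<close>, of 1] x_closed \<open>i < n\<close> by (simp add: Pi_iff)
  qed
qed simp

lemma M_mult_filt: "\<mu> \<in> M \<Longrightarrow> b \<in> filt k \<Longrightarrow> \<mu> \<otimes> b \<in> filt (Suc k)"
  using filt_mult[of \<mu> 1 b k] M_subset_filt by auto

text \<open>Write the monomials as \<open>a \<oplus> f\<close> and \<open>b \<oplus> g\<close> with
  errors \<open>f\<close>, \<open>g\<close> of higher weight. In their product
  \<open>a \<otimes> b\<close> lies in \<open>I \<cdot> J\<close>, and the rest has higher weight
  because \<open>a = mon \<alpha> \<ominus> f\<close> lies in
  \<open>filt (weight \<alpha>)\<close>.\<close>

lemma exps_add:
  assumes "ideal I R" "ideal J R" "\<alpha> \<in> exps I" "\<beta> \<in> exps J"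
  shows "(\<lambda>i. \<alpha> i + \<beta> i) \<in> exps (I \<cdot> J)"
proof -
  obtain a f where a: "a \<in> I" "f \<in> filt (Suc (weight \<alpha>))" "mon \<alpha> = a \<oplus> f"
    using assms(3) unfolding exps_def by (auto elim: ideal_add_memE)
  obtain b g where b: "b \<in> J" "g \<in> filt (Suc (weight \<beta>))" "mon \<beta> = b \<oplus> g"
    using assms(4) unfolding exps_def by (auto elim: ideal_add_memE)
  let ?k = "weight \<alpha> + weight \<beta>"
  have carr: "a \<in> carrier R" "f \<in> carrier R" "b \<in> carrier R" "g \<in> carrier R"
    using a b assms ideal.Icarr filt_closed by metis+
  have "a = mon \<alpha> \<ominus> f"
    using a(3) carr by (simp add: a_minus_def a_assoc r_neg)
  moreover have "f \<in> filt (weight \<alpha>)" using a(2) filt_antimono[of "weight \<alpha>" "Suc (weight \<alpha>)"] by auto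
  ultimately have "a \<in> filt (weight \<alpha>)"
    by (auto intro: ideal_minus_closed mon_in_filt)
  then have "a \<otimes> g \<in> filt (Suc ?k)" "f \<otimes> mon \<beta> \<in> filt (Suc ?k)"
    using filt_mult[OF _ b(2)] filt_mult[OF a(2), of "mon \<beta>" "weight \<beta>"] by (auto intro: mon_in_filt)
  then have "a \<otimes> g \<oplus> f \<otimes> mon \<beta> \<in> filt (Suc ?k)"
    by (auto intro: ideal_add_closed)
  moreover have "a \<otimes> b \<in> I \<cdot> J"
    using a b by (auto intro: ideal_prod.prod)
  moreover have "mon \<alpha> \<otimes> mon \<beta> = a \<otimes> b \<oplus> (a \<otimes> g \<oplus> f \<otimes> mon \<beta>)"
    unfolding a(3) b(3) using carr by algebra
  ultimately have "mon \<alpha> \<otimes> mon \<beta> \<in> I \<cdot> J <+> filt (Suc ?k)"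
    by (auto simp: set_add_def')
  then show ?thesis
    by (simp add: exps_def mon_add weight_add)
qed

lemma exps_mono: "I \<subseteq> J \<Longrightarrow> exps I \<subseteq> exps J"
  by (auto simp: exps_def set_add_def')

lemma bounded_idealD: "bounded_ideal I \<Longrightarrow> ideal I R"
  by (simp add: bounded_ideal_def)

lemma mon_in_bounded_ideal:
  assumes "bounded_ideal I" "i < n" "N \<le> \<alpha> i"
  shows "mon \<alpha> \<in> I"
proof -
  interpret ideal I R using assms by (simp add: bounded_ideal_def)
  have "mon \<alpha> = mon (\<lambda>j. (if j = i then \<alpha> i - N else \<alpha> j) + (if j = i then N else 0))"
    using assms by (intro mon_cong) auto
  also have "\<dots> = mon (\<lambda>j. if j = i then \<alpha> i - N else \<alpha> j) \<otimes> x i [^] N"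
    unfolding mon_add using assms(2) by (simp add: mon_single)
  also have "\<dots> \<in> I"
    using assms by (intro I_l_closed) (auto simp: bounded_ideal_def)
  finally show ?thesis .
qed

text \<open>Upward closure is \<open>exps_add\<close> with the unit ideal as second factor, since
  every exponent belongs to \<open>exps (carrier R)\<close>.\<close>

lemma upset_exps:
  assumes "bounded_ideal I"
  shows "upset n N (exps I)"
  unfolding upset_def
proof (intro conjI allI impI)
  interpret ideal I R using assms by (rule bounded_idealD)
  have I: "ideal I R" by (rule is_ideal)
  fix \<alpha> \<beta> :: "nat \<Rightarrow> nat" assume \<alpha>: "\<alpha> \<in> exps I" and le: "\<alpha> \<le> \<beta>"
  define \<gamma> where "\<gamma> i = \<beta> i - \<alpha> i" for i
  have \<beta>: "\<beta> = (\<lambda>i. \<alpha> i + \<gamma> i)"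
    using le by (auto simp: \<gamma>_def le_fun_def)
  have "\<gamma> \<in> exps (carrier R)"
    by (simp add: exps_def ideal_add_memI1 oneideal)
  from exps_add[OF I oneideal \<alpha> this] have "\<beta> \<in> exps (I \<cdot> carrier R)"
    by (simp add: \<beta>)
  with exps_mono[of "I \<cdot> carrier R" I] ideal_prod_inter[OF I oneideal] show "\<beta> \<in> exps I"
    by blast
next
  fix \<alpha> :: "nat \<Rightarrow> nat" and i assume "i < n" "N \<le> \<alpha> i"
  with mon_in_bounded_ideal[OF assms] show "\<alpha> \<in> exps I"
    by (simp add: exps_def ideal_add_memI1 bounded_idealD[OF assms])
qed

text \<open>Neither \<open>mon\<close> nor \<open>weight\<close> sees the values at indices from
  \<open>n\<close> on, so these may be reset to zero, as \<open>box\<close> demands.\<close>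

lemma mon_cases:
  assumes "bounded_ideal J"
  shows "mon \<beta> \<in> J \<or> (\<exists>\<alpha>\<in>box n N. mon \<alpha> = mon \<beta> \<and> weight \<alpha> = weight \<beta>)"
proof (cases "\<exists>i<n. N \<le> \<beta> i")
  case True
  with assms show ?thesis by (auto intro: mon_in_bounded_ideal)
next
  case False
  then have "(\<lambda>i. if i < n then \<beta> i else 0) \<in> box n N"
    by (auto simp: box_def not_le)
  moreover have "mon (\<lambda>i. if i < n then \<beta> i else 0) = mon \<beta>"
    "weight (\<lambda>i. if i < n then \<beta> i else 0) = weight \<beta>"
    by (auto intro: mon_cong weight_cong)
  ultimately show ?thesis by blast
qed

lemma filt_subset_bounded_ideal:
  assumes "bounded_ideal J" "N ^ n \<le> k"
  shows "filt k \<subseteq> J"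
proof (rule filt_le[OF bounded_idealD[OF assms(1)]])
  fix \<alpha> assume "k \<le> weight \<alpha>"
  with mon_cases[OF assms(1), of \<alpha>] assms(2) weight_less show "mon \<alpha> \<in> J"
    by fastforce
qed

text \<open>By injectivity of the weight at most one exponent in the box has weight
  \<open>k\<close>, and monomials with some exponent at least \<open>N\<close> lie in
  \<open>J\<close>. So modulo \<open>J\<close> each step of the filtration is zero or generated by
  one monomial.\<close>

lemma filt_step:
  assumes J: "bounded_ideal J"
  shows "(\<forall>\<alpha>\<in>box n N. weight \<alpha> \<noteq> k) \<Longrightarrow> filt k \<subseteq> J <+> filt (Suc k)"
    and "\<alpha> \<in> box n N \<Longrightarrow> weight \<alpha> = k \<Longrightarrow> filt k \<subseteq> PIdl (mon \<alpha>) <+> (J <+> filt (Suc k))"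
proof -
  note J' = bounded_idealD[OF J]
  have "ideal (J <+> filt (Suc k)) R"
    by (intro add_ideals J' filt_ideal)
  note J'' = this
  have *: "mon \<beta> \<in> J <+> filt (Suc k)"
    if "k \<le> weight \<beta>" "\<forall>\<alpha>\<in>box n N. weight \<alpha> = k \<longrightarrow> mon \<alpha> \<noteq> mon \<beta>" for \<beta>
  proof (cases "k = weight \<beta>")
    case True
    with that mon_cases[OF J, of \<beta>] have "mon \<beta> \<in> J" by auto
    then show ?thesis by (intro ideal_add_memI1 J' filt_ideal)
  next
    case False
    with that have "mon \<beta> \<in> filt (Suc k)" by (auto intro: mon_in_filt)
    then show ?thesis by (intro ideal_add_memI2 J' filt_ideal)
  qed
  show "filt k \<subseteq> J <+> filt (Suc k)" if "\<forall>\<alpha>\<in>box n N. weight \<alpha> \<noteq> k"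
    using that by (intro filt_le J'' *) auto
  show "filt k \<subseteq> PIdl (mon \<alpha>) <+> (J <+> filt (Suc k))" if "\<alpha> \<in> box n N" "weight \<alpha> = k"
  proof (rule filt_le)
    have P: "ideal (PIdl (mon \<alpha>)) R" by (intro cgenideal_ideal mon_closed)
    then show "ideal (PIdl (mon \<alpha>) <+> (J <+> filt (Suc k))) R"
      by (intro add_ideals J'')
    fix \<beta> assume \<beta>: "k \<le> weight \<beta>"
    show "mon \<beta> \<in> PIdl (mon \<alpha>) <+> (J <+> filt (Suc k))"
    proof (cases "mon \<beta> = mon \<alpha>")
      case True
      then show ?thesis
        by (simp add: ideal_add_memI1 P J'' cgenideal_self)
    next
      case False
      then have "\<forall>\<gamma>\<in>box n N. weight \<gamma> = k \<longrightarrow> mon \<gamma> \<noteq> mon \<beta>"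
        using that inj_onD[OF weight_inj_on] by metis
      with \<beta> have "mon \<beta> \<in> J <+> filt (Suc k)" by (rule *)
      then show ?thesis by (rule ideal_add_memI2[OF P J''])
    qed
  qed
qed

text \<open>Leading exponents determine the ideal, as for Groebner bases: subtracting elements of
  \<open>J\<close> pushes an element of \<open>J'\<close> ever higher in the filtration, until
  \<open>filt (N ^ n) \<subseteq> J\<close> ends the process.\<close>

lemma bounded_ideal_eqI:
  assumes J: "bounded_ideal J" and J': "bounded_ideal J'" and sub: "J \<subseteq> J'"
    and exps: "exps J' \<inter> box n N \<subseteq> exps J"
  shows "J = J'"
proof -
  note Ji = bounded_idealD[OF J] and J'i = bounded_idealD[OF J']
  have "J' \<subseteq> J <+> filt k" for k
  proof (induction k)
    case 0
    then show ?case
      using ideal_add_memI2[OF Ji filt_ideal, of _ 0] ideal.Icarr[OF J'i] by (auto simp: filt_0)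
  next
    case (Suc k)
    let ?L = "J <+> filt (Suc k)"
    have L: "ideal ?L R" by (intro add_ideals Ji filt_ideal)
    have JL: "J \<subseteq> ?L" using ideal_add_memI1[OF Ji filt_ideal] by blast
    have g: "g \<in> ?L" if "g \<in> filt k" "g \<in> J'" for g
    proof (cases "\<exists>\<alpha>\<in>box n N. weight \<alpha> = k")
      case False
      with filt_step(1)[OF J] that show ?thesis by blast
    next
      case True
      then obtain \<alpha> where \<alpha>: "\<alpha> \<in> box n N" "weight \<alpha> = k" by blast
      then have "g \<in> PIdl (mon \<alpha>) <+> ?L"
        using filt_step(2)[OF J] that(1) by blast
      then obtain c h where c: "c \<in> carrier R" and h: "h \<in> ?L"
        and g: "g = c \<otimes> mon \<alpha> \<oplus> h"
        unfolding cgenideal_def by (rule ideal_add_memE) blast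
      have carr: "g \<in> carrier R" "h \<in> carrier R"
        using that(1) filt_closed ideal.Icarr[OF L h] by auto
      have "c \<otimes> mon \<alpha> \<in> ?L"
      proof (cases "c \<in> M")
        case True
        then have "c \<otimes> mon \<alpha> \<in> filt (Suc k)"
          using \<alpha> by (intro M_mult_filt mon_in_filt) auto
        then show ?thesis by (intro ideal_add_memI2 Ji filt_ideal)
      next
        \<comment> \<open>Here \<open>c\<close> is invertible modulo \<open>M\<close>, so
          \<open>mon \<alpha>\<close> equals \<open>r \<otimes> g\<close> up to
          \<open>J <+> filt (Suc k)\<close>. Thus \<open>\<alpha>\<close> is in
          \<open>exps J'\<close>, hence in \<open>exps J\<close> by assumption.\<close>
        case False
        with maximalideal_unit_mod[OF maximal c] obtain r \<mu>
          where r: "r \<in> carrier R" and \<mu>: "\<mu> \<in> M" and one: "\<one> = r \<otimes> c \<oplus> \<mu>" by blast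
        have \<mu>c: "\<mu> \<in> carrier R"
          using \<mu> M_subset_filt filt_closed by blast
        have "mon \<alpha> = \<one> \<otimes> mon \<alpha>" by simp
        also have "\<dots> = r \<otimes> g \<oplus> (\<mu> \<otimes> mon \<alpha> \<ominus> r \<otimes> h)"
          unfolding one g using r c carr \<mu>c mon_closed[of \<alpha>] by algebra
        finally have m: "mon \<alpha> = r \<otimes> g \<oplus> (\<mu> \<otimes> mon \<alpha> \<ominus> r \<otimes> h)" .
        let ?L' = "J' <+> filt (Suc k)"
        have L': "ideal ?L' R" by (intro add_ideals J'i filt_ideal)
        have "?L \<subseteq> ?L'" using sub by (auto simp: set_add_def')
        then have "r \<otimes> h \<in> ?L'"
          using ideal.I_l_closed[OF L h r] by blast
        moreover have "r \<otimes> g \<in> ?L'"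
          using ideal.I_l_closed[OF J'i that(2) r] by (intro ideal_add_memI1 J'i filt_ideal)
        moreover have "\<mu> \<otimes> mon \<alpha> \<in> ?L'"
          using \<alpha> \<mu> by (intro ideal_add_memI2 J'i filt_ideal M_mult_filt mon_in_filt) auto
        ultimately have "mon \<alpha> \<in> ?L'"
          by (subst m) (intro ideal_add_closed ideal_minus_closed L')
        with \<alpha> exps have "mon \<alpha> \<in> ?L" by (auto simp: exps_def)
        then show ?thesis using ideal.I_l_closed[OF L _ c] by blast
      qed
      then show ?thesis unfolding g using h by (rule ideal_add_closed[OF L])
    qed
    show ?case
    proof
      fix f assume f: "f \<in> J'"
      with Suc obtain j g where jg: "j \<in> J" "g \<in> filt k" "f = j \<oplus> g"
        by (auto elim!: ideal_add_memE dest!: subsetD)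
      have carr: "j \<in> carrier R" "g \<in> carrier R"
        using jg filt_closed ideal.Icarr[OF Ji] by auto
      have "g = f \<ominus> j" unfolding jg(3) using carr by algebra
      then have "g \<in> J'" using f jg sub ideal_minus_closed[OF J'i] by blast
      with jg g JL show "f \<in> ?L" by (auto intro!: ideal_add_closed[OF L])
    qed
  qed
  moreover have "J <+> filt (N ^ n) \<subseteq> J"
    by (intro ideal_add_subset Ji filt_subset_bounded_ideal J) auto
  ultimately show ?thesis using sub by blast
qed

lemma bounded_ideal_mono: "bounded_ideal I \<Longrightarrow> ideal J R \<Longrightarrow> I \<subseteq> J \<Longrightarrow> bounded_ideal J"
  by (auto simp: bounded_ideal_def)

text \<open>By \<open>bounded_ideal_eqI\<close> each strict inclusion gains an exponent in the box,
  so the number of missing exponents drops at every link.\<close>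

lemma chain_le_card_exps:
  assumes I: "bounded_ideal I"
    and c: "\<forall>i\<le>l. ideal (c i) R \<and> I \<subseteq> c i" "\<forall>i<l. c i \<subset> c (Suc i)"
  shows "l \<le> card (box n N - exps I)"
proof -
  have b: "bounded_ideal (c i)" if "i \<le> l" for i
    using c(1) that I by (auto intro: bounded_ideal_mono)
  have less: "card (box n N - exps (c (Suc i))) < card (box n N - exps (c i))" if "i < l" for i
  proof (rule psubset_card_mono)
    have "c i \<subset> c (Suc i)" using that c(2) by blast
    moreover have "\<not> exps (c (Suc i)) \<inter> box n N \<subseteq> exps (c i)"
      using bounded_ideal_eqI[OF b[of i] b[of "Suc i"]] that calculation by auto
    ultimately show "box n N - exps (c (Suc i)) \<subset> box n N - exps (c i)"
      using exps_mono[of "c i" "c (Suc i)"] by blast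
  qed simp
  have "i + card (box n N - exps (c i)) \<le> card (box n N - exps (c 0))" if "i \<le> l" for i
    using that
  proof (induction i)
    case (Suc i)
    with less[of i] show ?case by simp
  qed simp
  from this[of l] have "l \<le> card (box n N - exps (c 0))" by simp
  also have "\<dots> \<le> card (box n N - exps I)"
    using c(1) exps_mono[of I "c 0"] by (intro card_mono) auto
  finally show ?thesis .
qed

end

text \<open>Repetitions are removed from a decreasing sequence. The chain is to increase, so it
  starts at \<open>G K\<close>, and each further drop is put in front.\<close>

lemma strict_chain_of_decseq:
  fixes G :: "nat \<Rightarrow> 'c set"
  assumes "\<And>k. G (Suc k) \<subseteq> G k"
  shows "\<exists>c. c 0 = G K \<and> (\<forall>i\<le>card {k. k < K \<and> G (Suc k) \<noteq> G k}. c i \<in> range G)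
    \<and> (\<forall>i<card {k. k < K \<and> G (Suc k) \<noteq> G k}. c i \<subset> c (Suc i))"
proof (induction K)
  case 0
  then show ?case by (intro exI[of _ "\<lambda>_. G 0"]) auto
next
  case (Suc K)
  then obtain c where c: "c 0 = G K" "\<forall>i\<le>card {k. k < K \<and> G (Suc k) \<noteq> G k}. c i \<in> range G"
    "\<forall>i<card {k. k < K \<and> G (Suc k) \<noteq> G k}. c i \<subset> c (Suc i)" by blast
  show ?case
  proof (cases "G (Suc K) = G K")
    case True
    then have "{k. k < Suc K \<and> G (Suc k) \<noteq> G k} = {k. k < K \<and> G (Suc k) \<noteq> G k}"
      by (auto simp: less_Suc_eq)
    with c True show ?thesis by auto
  next
    case False
    then have "{k. k < Suc K \<and> G (Suc k) \<noteq> G k} = insert K {k. k < K \<and> G (Suc k) \<noteq> G k}"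
      by (auto simp: less_Suc_eq)
    then have card: "card {k. k < Suc K \<and> G (Suc k) \<noteq> G k} = Suc (card {k. k < K \<and> G (Suc k) \<noteq> G k})"
      by simp
    have "G (Suc K) \<subset> c 0" using False assms[of K] c(1) by blast
    with c(2,3) show ?thesis
      unfolding card by (intro exI[of _ "case_nat (G (Suc K)) c"]) (auto split: nat.split)
  qed
qed

text \<open>For the lower bound, \<open>I <+> filt k\<close> drops at the weight of every box
  exponent outside \<open>exps I\<close>, and these weights are distinct.\<close>

lemma (in monomials) chain_length_ideals:
  assumes I: "bounded_ideal I"
  shows "chain_length {J. ideal J R \<and> I \<subseteq> J} = enat (card (box n N - exps I))"
proof (rule antisym)
  show "chain_length {J. ideal J R \<and> I \<subseteq> J} \<le> enat (card (box n N - exps I))"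
    unfolding chain_length_def
  proof (rule Sup_least, clarify)
    fix l c assume "\<forall>i\<le>l. c i \<in> {J. ideal J R \<and> I \<subseteq> J}" "\<forall>i<l. c i \<subset> c (Suc i)"
    then show "enat l \<le> enat (card (box n N - exps I))"
      using chain_le_card_exps[OF I, of l c] by simp
  qed
  define G where "G k = I <+> filt k" for k
  note Ii = bounded_idealD[OF I]
  have G: "ideal (G k) R" "I \<subseteq> G k" for k
    unfolding G_def using ideal_add_memI1[OF Ii filt_ideal] by (auto intro!: add_ideals Ii)
  have dec: "G (Suc k) \<subseteq> G k" for k
    unfolding G_def using filt_antimono[of k "Suc k"] by (auto simp: set_add_def')
  let ?s = "card {k. k < N ^ n \<and> G (Suc k) \<noteq> G k}"
  have "card (box n N - exps I) = card (weight ` (box n N - exps I))"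
    using inj_on_subset[OF weight_inj_on] by (intro card_image[symmetric]) auto
  also have "\<dots> \<le> ?s"
  proof (rule card_mono)
    show "weight ` (box n N - exps I) \<subseteq> {k. k < N ^ n \<and> G (Suc k) \<noteq> G k}"
    proof clarsimp
      fix \<alpha> assume \<alpha>: "\<alpha> \<in> box n N" "\<alpha> \<notin> exps I"
      have "mon \<alpha> \<in> G (weight \<alpha>)"
        unfolding G_def by (intro ideal_add_memI2 Ii filt_ideal mon_in_filt) simp
      with \<alpha> show "weight \<alpha> < N ^ n \<and> G (Suc (weight \<alpha>)) \<noteq> G (weight \<alpha>)"
        by (auto simp: weight_less exps_def G_def)
    qed
  qed simp
  finally have "enat (card (box n N - exps I)) \<le> enat ?s" by simp
  also have "\<dots> \<le> chain_length {J. ideal J R \<and> I \<subseteq> J}"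
  proof -
    obtain c where "\<forall>i\<le>?s. c i \<in> range G" "\<forall>i<?s. c i \<subset> c (Suc i)"
      using strict_chain_of_decseq[of G "N ^ n"] dec by blast
    moreover have "range G \<subseteq> {J. ideal J R \<and> I \<subseteq> J}"
      using G by blast
    ultimately show ?thesis
      unfolding chain_length_def by (intro Sup_upper) blast
  qed
  finally show "enat (card (box n N - exps I)) \<le> chain_length {J. ideal J R \<and> I \<subseteq> J}" .
qed

section \<open>Lengths of quotient rings\<close>

lemma chain_length_le:
  assumes "\<And>I. I \<in> S \<Longrightarrow> f I \<in> T" "\<And>I J. I \<in> S \<Longrightarrow> J \<in> S \<Longrightarrow> I \<subset> J \<Longrightarrow> f I \<subset> f J"
  shows "chain_length S \<le> chain_length T"
  unfolding chain_length_def
proof (rule Sup_subset_mono, clarify)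
  fix l c assume c: "\<forall>i\<le>l. c i \<in> S" "\<forall>i<l. c i \<subset> c (Suc i)"
  show "\<exists>l'. enat l = enat l' \<and> (\<exists>c. (\<forall>i\<le>l'. c i \<in> T) \<and> (\<forall>i<l'. c i \<subset> c (Suc i)))"
    using c assms by (intro exI[of _ l] conjI exI[of _ "\<lambda>i. f (c i)"]) auto
qed

text \<open>An ideal of the quotient is a set of cosets, and their union is its preimage. Both
  directions of the ideal correspondence preserve strict inclusion, so chains can be carried
  across.\<close>

lemma (in ring) ring_length_Quot:
  assumes "ideal I R"
  shows "ring_length (R Quot I) = chain_length {J. ideal J R \<and> I \<subseteq> J}"
  unfolding ring_length_def
proof (rule antisym)
  note bij = quot_ideal_correspondence[OF assms]
  note inj = bij_betw_imp_inj_on[OF bij]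
  show "chain_length {J. ideal J R \<and> I \<subseteq> J} \<le> chain_length {J. ideal J (R Quot I)}"
  proof (rule chain_length_le)
    fix J assume "J \<in> {J. ideal J R \<and> I \<subseteq> J}"
    then show "(+>) I ` J \<in> {J. ideal J (R Quot I)}"
      using bij_betwE[OF bij] by blast
  next
    fix J J' assume J: "J \<in> {J. ideal J R \<and> I \<subseteq> J}" "J' \<in> {J. ideal J R \<and> I \<subseteq> J}" and less: "J \<subset> J'"
    have "(+>) I ` J \<noteq> (+>) I ` J'"
      using inj_onD[OF inj _ J] less by auto
    with less show "(+>) I ` J \<subset> (+>) I ` J'"
      by (simp add: psubset_eq image_mono)
  qed
  show "chain_length {J. ideal J (R Quot I)} \<le> chain_length {J. ideal J R \<and> I \<subseteq> J}"
  proof (rule chain_length_le)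
    have ex: "ideal (\<Union> A) R \<and> I \<subseteq> \<Union> A \<and> (+>) I ` (\<Union> A) = A"
      if "A \<in> {J. ideal J (R Quot I)}" for A :: "'a set set"
    proof -
      have "A \<in> (\<lambda>J. (+>) I ` J) ` {J. ideal J R \<and> I \<subseteq> J}"
        using that unfolding bij_betw_imp_surj_on[OF bij] .
      then obtain J where J: "ideal J R" "I \<subseteq> J" "A = (+>) I ` J"
        by (rule imageE) blast
      have "\<Union> A = J"
        using ideal_incl_iff[OF assms J(1)] J(2,3) by simp
      with J show ?thesis by metis
    qed
    then show "\<Union> A \<in> {J. ideal J R \<and> I \<subseteq> J}" if "A \<in> {J. ideal J (R Quot I)}" for A :: "'a set set"
      using that by simp
    show "\<Union> A \<subset> \<Union> B"
      if "A \<in> {J. ideal J (R Quot I)}" "B \<in> {J. ideal J (R Quot I)}" "A \<subset> B" for A B :: "'a set set"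
    proof
      show "\<Union> A \<subseteq> \<Union> B" using that(3) by blast
      show "\<Union> A \<noteq> \<Union> B"
      proof
        assume "\<Union> A = \<Union> B"
        then have "(+>) I ` (\<Union> A) = (+>) I ` (\<Union> B)" by (rule arg_cong)
        then have "A = B"
          unfolding ex[OF that(1), THEN conjunct2, THEN conjunct2]
            ex[OF that(2), THEN conjunct2, THEN conjunct2] .
        with that(3) show False by blast
      qed
    qed
  qed
qed

text \<open>All three lengths are covolumes of leading exponents in one common box, to which
  \<open>covolume_sumset_le\<close> applies.\<close>

lemma (in cring) ring_length_Quot_prod_root:
  fixes x :: "nat \<Rightarrow> 'a"
  assumes x: "x \<in> {..<Suc d} \<rightarrow> carrier R" "M = Idl (x ` {..<Suc d})" "maximalideal M R"
    and I: "ideal I R" "\<And>i. i < Suc d \<Longrightarrow> \<exists>r::nat. x i [^] r \<in> I"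
    and J: "ideal J R" "\<And>i. i < Suc d \<Longrightarrow> \<exists>r::nat. x i [^] r \<in> J"
  obtains s t u :: nat where "ring_length (R Quot I) = enat s" "ring_length (R Quot J) = enat t"
    "ring_length (R Quot (I \<cdot> J)) = enat u" "root (Suc d) u \<le> root (Suc d) s + root (Suc d) t"
proof -
  have pow: "x i [^] l \<in> L" if "ideal L R" "x i [^] k \<in> L" "k \<le> l" "i < Suc d" for L i and k l :: nat
  proof -
    have "x i \<in> carrier R" using x(1) that by auto
    then have "x i [^] l = x i [^] k \<otimes> x i [^] (l - k)"
      using that by (simp add: nat_pow_mult)
    with \<open>x i \<in> carrier R\<close> that show ?thesis by (simp add: ideal.I_r_closed)
  qed
  obtain r r' :: "nat \<Rightarrow> nat" where r: "\<And>i. i < Suc d \<Longrightarrow> x i [^] r i \<in> I" "\<And>i. i < Suc d \<Longrightarrow> x i [^] r' i \<in> J"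
    using I(2) J(2) by metis
  \<comment> \<open>The sum dominates all exponents involved, and \<open>Suc\<close> keeps the side
    of the box positive.\<close>
  define q where "q = Suc (\<Sum>i<Suc d. r i + r' i)"
  have le: "r i + r' i \<le> q" if "i < Suc d" for i
    using member_le_sum[of i "{..<Suc d}" "\<lambda>i. r i + r' i"] that by (simp add: q_def del: sum.lessThan_Suc)
  have q: "x i [^] q \<in> I" "x i [^] q \<in> J" if "i < Suc d" for i
    using pow[OF I(1) r(1)] pow[OF J(1) r(2)] le[OF that] that by auto
  \<comment> \<open>The side is doubled because a product of two \<open>q\<close>-th powers is
    needed to land in \<open>I \<cdot> J\<close>.\<close>
  interpret monomials R x "Suc d" "q + q" M
    by (intro monomials.intro is_cring monomials_axioms.intro x) (simp add: q_def)
  have IJ: "ideal (I \<cdot> J) R" by (intro ideal_prod_is_ideal I J)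
  have "x i [^] (q + q) \<in> I \<cdot> J" if "i < Suc d" for i
  proof -
    have "x i \<in> carrier R" using x(1) that by auto
    then have "x i [^] (q + q) = x i [^] q \<otimes> x i [^] q" by (simp add: nat_pow_mult)
    then show ?thesis using q[OF that] by (auto intro: ideal_prod.prod)
  qed
  then have b: "bounded_ideal I" "bounded_ideal J" "bounded_ideal (I \<cdot> J)"
    using q pow[of _ _ q "q + q"] I J IJ by (auto simp: bounded_ideal_def)
  show ?thesis
  proof (rule that)
    let ?u = "\<lambda>L. card (box (Suc d) (q + q) - exps L)"
    show "ring_length (R Quot I) = enat (?u I)" "ring_length (R Quot J) = enat (?u J)"
      "ring_length (R Quot (I \<cdot> J)) = enat (?u (I \<cdot> J))"
      using I J IJ b by (simp_all only: ring_length_Quot chain_length_ideals)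
    show "root (Suc d) (?u (I \<cdot> J)) \<le> root (Suc d) (?u I) + root (Suc d) (?u J)"
      by (rule covolume_sumset_le[OF upset_exps upset_exps upset_exps])
        (use b I J exps_add in auto)
  qed
qed

section \<open>Volumes\<close>

lemma ennreal_root_le_iff:
  assumes "n > 0" "c \<ge> 0"
  shows "ennreal_root n y \<le> ennreal c \<longleftrightarrow> y \<le> ennreal (c ^ n)"
proof (cases y)
  case (real r)
  have "root n r \<le> c \<longleftrightarrow> r \<le> c ^ n"
    using assms real real_root_le_iff[of n r "c ^ n"] by (simp add: real_root_power_cancel)
  with real assms show ?thesis by (simp add: ennreal_root_def)
next
  case top
  then show ?thesis by (simp add: ennreal_root_def top_unique)
qed

lemma ennreal_root_mono:
  assumes "n > 0" "y \<le> z"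
  shows "ennreal_root n y \<le> ennreal_root n z"
proof (cases z)
  case (real r)
  then have "ennreal_root n z = ennreal (root n r)" "ennreal ((root n r) ^ n) = z"
    using assms(1) by (simp_all add: ennreal_root_def)
  with assms real show ?thesis by (simp add: ennreal_root_le_iff)
qed (simp add: ennreal_root_def)

lemma ennreal_root_of_nat_divide:
  assumes "n > 0" "c > 0"
  shows "ennreal_root n (of_nat u / ennreal c) = ennreal (root n u / root n c)"
proof -
  have "of_nat u / ennreal c = ennreal (u / c)"
    using assms by (simp add: divide_ennreal ennreal_of_nat_eq_real_of_nat)
  then show ?thesis
    using assms by (simp add: ennreal_root_def real_root_divide)
qed

text \<open>For finite limits superior, \<open>f\<close> and \<open>g\<close> are eventually below
  the \<open>n\<close>-th powers of \<open>a + e / 2\<close> and \<open>b + e / 2\<close>, so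
  \<open>h\<close> is eventually at most \<open>(a + b + e) ^ n\<close>; then \<open>e\<close> tends
  to zero.\<close>

lemma ennreal_root_Limsup_add_le:
  fixes f g h :: "'i \<Rightarrow> ennreal"
  assumes n: "n > 0"
    and ev: "\<forall>\<^sub>F i in F. ennreal_root n (h i) \<le> ennreal_root n (f i) + ennreal_root n (g i)"
  shows "ennreal_root n (Limsup F h) \<le> ennreal_root n (Limsup F f) + ennreal_root n (Limsup F g)"
proof (cases "Limsup F f = \<infinity> \<or> Limsup F g = \<infinity>")
  case True
  then show ?thesis by (auto simp: ennreal_root_def)
next
  case False
  have eventually_le: "\<forall>\<^sub>F i in F. ennreal_root n (f i) \<le> ennreal (a + e)"
    if "Limsup F f \<noteq> \<infinity>" "a = root n (enn2real (Limsup F f))" "e > 0" for f :: "'i \<Rightarrow> ennreal" and a e :: real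
  proof -
    have a: "a \<ge> 0" "Limsup F f = ennreal (a ^ n)"
      using that n by (simp_all add: infinity_ennreal_def less_top[symmetric])
    have "a ^ n < (a + e) ^ n"
      using a(1) n that(3) by (intro power_strict_mono) simp_all
    with a have "Limsup F f < ennreal ((a + e) ^ n)"
      by (simp add: ennreal_less_iff)
    then have "\<forall>\<^sub>F i in F. f i < ennreal ((a + e) ^ n)"
      by (rule Limsup_lessD)
    then show ?thesis
      by eventually_elim (use a(1) n that(3) in \<open>simp add: ennreal_root_le_iff less_imp_le del: ennreal_plus\<close>)
  qed
  define a b where "a = root n (enn2real (Limsup F f))" and "b = root n (enn2real (Limsup F g))"
  have ab: "a \<ge> 0" "b \<ge> 0" using n by (simp_all add: a_def b_def)
  have "ennreal_root n (Limsup F h) \<le> ennreal (a + b)"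
  proof (rule ennreal_le_epsilon)
    fix e :: real assume "e > 0"
    have "\<forall>\<^sub>F i in F. ennreal_root n (f i) \<le> ennreal (a + e / 2)"
      "\<forall>\<^sub>F i in F. ennreal_root n (g i) \<le> ennreal (b + e / 2)"
      using False \<open>e > 0\<close> by (auto intro!: eventually_le simp: a_def b_def)
    with ev have "\<forall>\<^sub>F i in F. h i \<le> ennreal ((a + b + e) ^ n)"
    proof eventually_elim
      case (elim i)
      from elim(1) have "ennreal_root n (h i) \<le> ennreal (a + e / 2) + ennreal (b + e / 2)"
        using add_mono[OF elim(2,3)] by (rule order_trans)
      also have "\<dots> = ennreal (a + b + e)"
        using ab \<open>e > 0\<close> by (simp flip: ennreal_plus)
      finally show ?case
        using n ab \<open>e > 0\<close> by (simp add: ennreal_root_le_iff del: ennreal_plus)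
    qed
    then have "Limsup F h \<le> ennreal ((a + b + e) ^ n)"
      by (rule Limsup_bounded)
    then have "ennreal_root n (Limsup F h) \<le> ennreal (a + b + e)"
      using n ab \<open>e > 0\<close> by (simp add: ennreal_root_le_iff del: ennreal_plus)
    then show "ennreal_root n (Limsup F h) \<le> ennreal (a + b) + ennreal e"
      using ab \<open>e > 0\<close> by (simp flip: ennreal_plus)
  qed
  with False ab show ?thesis
    by (simp add: ennreal_root_def a_def b_def)
qed

lemma (in ring) ring_length_Quot_antimono:
  assumes "ideal I R" "ideal J R" "I \<subseteq> J"
  shows "ring_length (R Quot J) \<le> ring_length (R Quot I)"
  unfolding ring_length_Quot[OF assms(1)] ring_length_Quot[OF assms(2)]
  by (rule chain_length_le[where f = "\<lambda>L. L"]) (use assms in auto)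

theorem corollary4p4:
  fixes K :: "('a, 'b) ring_scheme" and k R :: "'a set" and n :: nat
    and \<Phi> :: "real set" and \<aa> \<bb> :: "real \<Rightarrow> 'a set" and \<delta> \<delta>' :: 'a
  assumes "fraction_field_of K R"
    and "regular_local_ring (K \<restriction> R)"
    and "krull_dim (K \<restriction> R) = enat n" and "n \<ge> 1"
    and "subfield k K" and "k \<subseteq> R" and "char_zero (K \<restriction> k)"
    and "essentially_finite_type K k R"
    and "\<Phi> \<subseteq> {0..}" and "\<And>l m. l \<in> \<Phi> \<Longrightarrow> m \<in> \<Phi> \<Longrightarrow> l + m \<in> \<Phi>"
    and "graded_family (K \<restriction> R) \<Phi> \<aa>" and "graded_family (K \<restriction> R) \<Phi> \<bb>"
    and "\<And>m m'. m \<in> \<Phi> \<Longrightarrow> m' \<in> \<Phi> \<Longrightarrow> m \<ge> m' \<Longrightarrow> \<aa> m \<subseteq> \<aa> m'"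
    and "\<And>m m'. m \<in> \<Phi> \<Longrightarrow> m' \<in> \<Phi> \<Longrightarrow> m \<ge> m' \<Longrightarrow> \<bb> m \<subseteq> \<bb> m'"
    and "\<delta> \<in> R - {\<zero>\<^bsub>K\<^esub>}" and "\<delta>' \<in> R - {\<zero>\<^bsub>K\<^esub>}"
    and "\<And>m. m \<in> \<Phi> \<Longrightarrow> (\<lambda>x. \<delta> \<otimes>\<^bsub>K\<^esub> x) ` asymptotic_multiplier_ideal K k R \<aa> m \<subseteq> \<aa> m"
    and "\<And>m. m \<in> \<Phi> \<Longrightarrow> (\<lambda>x. \<delta>' \<otimes>\<^bsub>K\<^esub> x) ` asymptotic_multiplier_ideal K k R \<bb> m \<subseteq> \<bb> m"
  shows "ennreal_root n (volume (K \<restriction> R) n \<Phi> (\<lambda>m. \<aa> m \<inter> \<bb> m))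
           \<le> ennreal_root n (volume (K \<restriction> R) n \<Phi> (\<lambda>m. \<aa> m \<cdot>\<^bsub>K \<restriction> R\<^esub> \<bb> m))
         \<and> ennreal_root n (volume (K \<restriction> R) n \<Phi> (\<lambda>m. \<aa> m \<cdot>\<^bsub>K \<restriction> R\<^esub> \<bb> m))
           \<le> ennreal_root n (volume (K \<restriction> R) n \<Phi> \<aa>) + ennreal_root n (volume (K \<restriction> R) n \<Phi> \<bb>)"
proof -
  let ?A = "K \<restriction> R" and ?M = "max_ideal (K \<restriction> R)" and ?F = "inf at_top (principal \<Phi>)"
  obtain ts where "cring ?A" and unique: "\<exists>!M. maximalideal M ?A" and ts: "regular_parameters ?A ts"
    using assms(2) by (auto simp: regular_local_ring_def local_ring_def)
  interpret A: cring ?A by fact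
  have maximal: "maximalideal ?M ?A"
    unfolding max_ideal_def using unique by (rule theI')
  \<comment> \<open>Regularity makes the number of generators of the maximal ideal equal to the
    dimension \<open>n\<close>, the degree of the root.\<close>
  have ts_closed: "set ts \<subseteq> carrier ?A" and len: "length ts = n" and M: "Idl\<^bsub>?A\<^esub> (set ts) = ?M"
    using ts assms(3) by (auto simp: regular_parameters_def)
  obtain d where n: "n = Suc d"
    using assms(4) by (cases n) auto
  have set_ts: "(!) ts ` {..<Suc d} = set ts"
    using len n by (auto simp: set_conv_nth)
  \<comment> \<open>Only large indices count. This excludes the index 0, where the family is the
    whole ring and the denominator vanishes.\<close>
  have ev: "\<forall>\<^sub>F m in ?F. m \<in> \<Phi> \<and> m > 0"
    unfolding eventually_inf_principal using eventually_gt_at_top[of 0] by eventually_elim simp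
  have primary: "ideal (\<cc> m) ?A" "\<And>i. i < Suc d \<Longrightarrow> \<exists>r::nat. ts ! i [^]\<^bsub>?A\<^esub> r \<in> \<cc> m"
    if "graded_family ?A \<Phi> \<cc>" "m \<in> \<Phi>" "m > 0" for \<cc> m
  proof -
    have *: "primary_to ?A ?M (\<cc> m)"
      using that by (auto simp: graded_family_def split: if_splits)
    then show "ideal (\<cc> m) ?A" by (simp add: primary_to_def)
    \<comment> \<open>Each parameter lies in the maximal ideal, which is the radical of
      \<open>\<cc> m\<close>.\<close>
    fix i assume "i < Suc d"
    then have "ts ! i \<in> ?M"
      using A.genideal_self[OF ts_closed] len n unfolding M by auto
    then show "\<exists>r::nat. ts ! i [^]\<^bsub>?A\<^esub> r \<in> \<cc> m"
      using * unfolding primary_to_def by blast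
  qed
  note \<aa> = primary[OF assms(11)] and \<bb> = primary[OF assms(12)]
  show ?thesis
    unfolding volume_def
  proof (intro conjI ennreal_root_mono ennreal_root_Limsup_add_le Limsup_mono)
    \<comment> \<open>The product lies in the intersection, so its quotient is at least as
      long.\<close>
    show "\<forall>\<^sub>F m in ?F. ennreal_of_enat (ring_length (?A Quot (\<aa> m \<inter> \<bb> m))) / ennreal (m ^ n / fact n)
        \<le> ennreal_of_enat (ring_length (?A Quot (\<aa> m \<cdot>\<^bsub>?A\<^esub> \<bb> m))) / ennreal (m ^ n / fact n)"
      using ev
    proof eventually_elim
      case (elim m)
      then have "ideal (\<aa> m) ?A" "ideal (\<bb> m) ?A" using \<aa> \<bb> by auto
      then show ?case
        by (intro divide_right_mono_ennreal, subst ennreal_of_enat_le_iff)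
          (intro A.ring_length_Quot_antimono A.ideal_prod_is_ideal A.i_intersect A.ideal_prod_inter)
    qed
    show "\<forall>\<^sub>F m in ?F. ennreal_root n (ennreal_of_enat (ring_length (?A Quot (\<aa> m \<cdot>\<^bsub>?A\<^esub> \<bb> m))) / ennreal (m ^ n / fact n))
        \<le> ennreal_root n (ennreal_of_enat (ring_length (?A Quot \<aa> m)) / ennreal (m ^ n / fact n))
          + ennreal_root n (ennreal_of_enat (ring_length (?A Quot \<bb> m)) / ennreal (m ^ n / fact n))"
      using ev
    proof eventually_elim
      case (elim m)
      define c where "c = m ^ n / fact n"
      have c: "c > 0" using elim by (simp add: c_def)
      obtain s t u :: nat where len: "ring_length (?A Quot \<aa> m) = enat s"
        "ring_length (?A Quot \<bb> m) = enat t" "ring_length (?A Quot (\<aa> m \<cdot>\<^bsub>?A\<^esub> \<bb> m)) = enat u"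
        and le: "root n u \<le> root n s + root n t"
        unfolding n
      proof (rule A.ring_length_Quot_prod_root[of "(!) ts" d ?M "\<aa> m" "\<bb> m"])
        show "(!) ts \<in> {..<Suc d} \<rightarrow> carrier ?A"
          using ts_closed set_ts by blast
      qed (use M set_ts maximal \<aa> \<bb> elim in auto)
      have "root n u / root n c \<le> root n s / root n c + root n t / root n c"
        using le c assms(4) by (simp add: divide_right_mono flip: add_divide_distrib)
      then show ?case
        unfolding len c_def[symmetric] ennreal_of_enat_enat
        using c assms(4) by (simp add: ennreal_root_of_nat_divide flip: ennreal_plus)
    qed
  qed (use assms(4) in auto)
qed

end
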